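(* Let $p\in L_2(0,1)$ and $r\in L_2(0,1)$ be real-valued, let $q=r'\in W_2^{-1}(0,1)$ in the distributional sense, and let $T(\lambda)=\lambda^2 I-\lambda B-A$, $\lambda\in\mathbb{C}$, be the quadratic operator pencil on $\operatorname{dom} T=\operatorname{dom} A$ associated with $p$ and $r$. Then the spectrum $\sigma(T)$ of the operator pencil $T$ is a discrete subset of $\mathbb{C}$ and consists of geometrically simple eigenvalues.
   Context: For an absolutely continuous function $y$ on $[0,1]$ put $y^{[1]}:=y'-ry$ (the quasi-derivative). Define $\ell(y)=-\bigl(y^{[1]}\bigr)'-r y^{[1]}-r^2y$ on $\operatorname{dom}\ell=\{y\in AC[0,1]\mid y^{[1]}\in AC[0,1],\ \ell(y)\in L_2(0,1)\}$; in the distributional sense $\ell(y)=-y''+qy$. The operator $A$ in $L_2(0,1)$ acts by $Ay=\ell(y)$ on $\operatorname{dom}A=\{y\in\operatorname{dom}\ell\mid y(0)=y(1)=0\}$; it is known to be self-adjoint, bounded below, with simple discrete spectrum. $B$ is the operator of multiplication by $2p$ in $L_2(0,1)$ (one has $\operatorname{dom}A\subset\operatorname{dom}B$), and $I$ is the identity. The notation $\operatorname{dom}$ in the claim means domain. The spectrum of an operator pencil $T$ is $\sigma(T)=\{\lambda\in\mathbb{C}\mid 0\in\sigma(T(\lambda))\}$, i.e. the set of $\lambda$ for which $T(\lambda)$ is not boundedly invertible. A number $\lambda$ is an eigenvalue of $T$ if $T(\lambda)y=0$ for some nonzero $y\in\operatorname{dom}T$; it is geometrically simple if the null-space of $T(\lambda)$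 has dimension one. *)

theory Defs
  imports "HOL-Analysis.Analysis"
begin

section \<open>The complex space $L_2(0,1)$\<close>

text \<open>The end points of the interval form a null set, so they may be included.\<close>

abbreviation leb01 :: "real measure" where
  "leb01 \<equiv> lebesgue_on {0..1}"

definition sq_integrable :: "(real \<Rightarrow> 'a::{banach, second_countable_topology}) \<Rightarrow> bool" where
  "sq_integrable f \<longleftrightarrow> f \<in> borel_measurable leb01 \<and> integrable leb01 (\<lambda>x. (norm (f x))\<^sup>2)"

lemma sq_integrable_add:
  assumes f: "sq_integrable f" and g: "sq_integrable g"
  shows "sq_integrable (\<lambda>x. f x + g x)"
proof -
  have [measurable]: "f \<in> borel_measurable leb01" "g \<in> borel_measurable leb01"
    using f g by (auto simp: sq_integrable_def)
  have "integrable leb01 (\<lambda>x. 2 * (norm (f x))\<^sup>2 + 2 * (norm (g x))\<^sup>2)"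
    using f g by (auto simp: sq_integrable_def)
  then have "integrable leb01 (\<lambda>x. (norm (f x + g x))\<^sup>2)"
  proof (rule Bochner_Integration.integrable_bound)
    show "AE x in leb01. norm ((norm (f x + g x))\<^sup>2)
            \<le> norm (2 * (norm (f x))\<^sup>2 + 2 * (norm (g x))\<^sup>2)"
    proof (intro AE_I2)
      fix x
      have "(norm (f x + g x))\<^sup>2 \<le> (norm (f x) + norm (g x))\<^sup>2"
        by (intro power_mono norm_triangle_ineq) auto
      also have "\<dots> \<le> 2 * (norm (f x))\<^sup>2 + 2 * (norm (g x))\<^sup>2"
        using zero_le_power2[of "norm (f x) - norm (g x)"]
        by (simp add: power2_sum power2_diff)
      finally show "norm ((norm (f x + g x))\<^sup>2)
          \<le> norm (2 * (norm (f x))\<^sup>2 + 2 * (norm (g x))\<^sup>2)" by simp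
    qed
  qed measurable
  then show ?thesis by (auto simp: sq_integrable_def)
qed

lemma sq_integrable_mult_left:
  fixes f :: "real \<Rightarrow> complex"
  shows "sq_integrable f \<Longrightarrow> sq_integrable (\<lambda>x. c * f x)"
  by (auto simp: sq_integrable_def norm_mult power_mult_distrib)

lemma sq_integrable_zero: "sq_integrable (\<lambda>x. 0)"
  by (simp add: sq_integrable_def)

definition L2_eq :: "(real \<Rightarrow> complex) \<Rightarrow> (real \<Rightarrow> complex) \<Rightarrow> bool" where
  "L2_eq f g \<longleftrightarrow> sq_integrable f \<and> sq_integrable g \<and> (AE x in leb01. f x = g x)"

quotient_type L2 = "real \<Rightarrow> complex" / partial: L2_eq
proof (rule part_equivpI)
  show "\<exists>f. L2_eq f f"
    by (rule exI[of _ "\<lambda>x. 0"]) (simp add: L2_eq_def sq_integrable_zero)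
  show "symp L2_eq" by (rule sympI) (auto simp: L2_eq_def)
  show "transp L2_eq" by (rule transpI) (auto simp: L2_eq_def elim: AE_mp)
qed

definition L2_seminorm :: "(real \<Rightarrow> complex) \<Rightarrow> real" where
  "L2_seminorm f = sqrt (LINT x|leb01. (cmod (f x))\<^sup>2)"

lemma L2_seminorm_cong:
  assumes "L2_eq f g" shows "L2_seminorm f = L2_seminorm g"
proof -
  have "(LINT x|leb01. (cmod (f x))\<^sup>2) = (LINT x|leb01. (cmod (g x))\<^sup>2)"
    using assms by (intro integral_cong_AE) (auto simp: L2_eq_def sq_integrable_def)
  then show ?thesis by (simp add: L2_seminorm_def)
qed

lemma L2_seminorm_eq_0_iff:
  assumes "sq_integrable f"
  shows "L2_seminorm f = 0 \<longleftrightarrow> (AE x in leb01. f x = 0)"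
  using assms by (simp add: L2_seminorm_def sq_integrable_def integral_nonneg_eq_0_iff_AE)

lemma L2_seminorm_triangle:
  assumes f: "sq_integrable f" and g: "sq_integrable g"
  shows "L2_seminorm (\<lambda>x. f x + g x) \<le> L2_seminorm f + L2_seminorm g"
proof -
  define a b where "a = L2_seminorm f" and "b = L2_seminorm g"
  have fg: "sq_integrable (\<lambda>x. f x + g x)" using f g by (rule sq_integrable_add)
  have nn: "a \<ge> 0" "b \<ge> 0" by (auto simp: a_def b_def L2_seminorm_def)
  have a2: "(LINT x|leb01. (cmod (f x))\<^sup>2) = a\<^sup>2" and b2: "(LINT x|leb01. (cmod (g x))\<^sup>2) = b\<^sup>2"
    by (auto simp: a_def b_def L2_seminorm_def)
  consider "a = 0" | "b = 0" | "a > 0" "b > 0" using nn by linarith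
  then show ?thesis
  proof cases
    case 1
    then have "AE x in leb01. f x = 0" using L2_seminorm_eq_0_iff[OF f] by (simp add: a_def)
    then have "L2_eq (\<lambda>x. f x + g x) g" using fg g by (auto simp: L2_eq_def elim: AE_mp)
    then show ?thesis using nn by (simp add: L2_seminorm_cong a_def)
  next
    case 2
    then have "AE x in leb01. g x = 0" using L2_seminorm_eq_0_iff[OF g] by (simp add: b_def)
    then have "L2_eq (\<lambda>x. f x + g x) f" using fg f by (auto simp: L2_eq_def elim: AE_mp)
    then show ?thesis using nn by (simp add: L2_seminorm_cong b_def)
  next
    case 3
    have pt: "(cmod (f x + g x))\<^sup>2 \<le> (1 + b / a) * (cmod (f x))\<^sup>2 + (1 + a / b) * (cmod (g x))\<^sup>2" for x
    proof -
      define u v where "u = cmod (f x)" and "v = cmod (g x)"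
      have "(cmod (f x + g x))\<^sup>2 \<le> (u + v)\<^sup>2"
        unfolding u_def v_def by (intro power_mono norm_triangle_ineq) auto
      moreover have "(1 + b / a) * u\<^sup>2 + (1 + a / b) * v\<^sup>2 - (u + v)\<^sup>2 = (b * u - a * v)\<^sup>2 / (a * b)"
        using 3 by (simp add: field_simps power2_eq_square)
      moreover have "(b * u - a * v)\<^sup>2 / (a * b) \<ge> 0" using 3 by simp
      ultimately show ?thesis unfolding u_def v_def by linarith
    qed
    have "(LINT x|leb01. (cmod (f x + g x))\<^sup>2)
        \<le> (LINT x|leb01. (1 + b / a) * (cmod (f x))\<^sup>2 + (1 + a / b) * (cmod (g x))\<^sup>2)"
      using f g fg pt by (intro integral_mono) (auto simp: sq_integrable_def)
    also have "\<dots> = (1 + b / a) * a\<^sup>2 + (1 + a / b) * b\<^sup>2"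
      using f g by (subst Bochner_Integration.integral_add) (auto simp: sq_integrable_def a2 b2)
    also have "\<dots> = (a + b)\<^sup>2" using 3 by (simp add: field_simps power2_eq_square)
    finally show ?thesis
      using nn unfolding L2_seminorm_def[of "\<lambda>x. f x + g x"] a_def[symmetric] b_def[symmetric]
      by (simp add: real_le_lsqrt)
  qed
qed

lemma L2_seminorm_mult: "L2_seminorm (\<lambda>x. c * f x) = cmod c * L2_seminorm f"
  by (simp add: L2_seminorm_def norm_mult power_mult_distrib real_sqrt_mult)

instantiation L2 :: real_normed_vector
begin

lift_definition zero_L2 :: L2 is "\<lambda>x. 0"
  by (simp add: L2_eq_def sq_integrable_zero)

lift_definition plus_L2 :: "L2 \<Rightarrow> L2 \<Rightarrow> L2" is "\<lambda>f g x. f x + g x"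
  by (auto simp: L2_eq_def sq_integrable_add elim!: AE_mp)

lift_definition uminus_L2 :: "L2 \<Rightarrow> L2" is "\<lambda>f x. - f x"
  by (auto simp: L2_eq_def sq_integrable_def elim!: AE_mp)

definition minus_L2 :: "L2 \<Rightarrow> L2 \<Rightarrow> L2" where
  "minus_L2 F G = F + (- G)"

lift_definition scaleR_L2 :: "real \<Rightarrow> L2 \<Rightarrow> L2" is "\<lambda>c f x. of_real c * f x"
  by (auto simp: L2_eq_def sq_integrable_mult_left elim!: AE_mp)

lift_definition norm_L2 :: "L2 \<Rightarrow> real" is L2_seminorm
  by (rule L2_seminorm_cong)

definition dist_L2 :: "L2 \<Rightarrow> L2 \<Rightarrow> real" where
  "dist_L2 F G = norm (F - G)"

definition sgn_L2 :: "L2 \<Rightarrow> L2" where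
  "sgn_L2 F = inverse (norm F) *\<^sub>R F"

definition uniformity_L2 :: "(L2 \<times> L2) filter" where
  "uniformity_L2 = (INF e\<in>{0<..}. principal {(F, G). dist F G < e})"

definition open_L2 :: "L2 set \<Rightarrow> bool" where
  "open_L2 S = (\<forall>F\<in>S. \<forall>\<^sub>F (F', G) in uniformity. F' = F \<longrightarrow> G \<in> S)"

instance
proof
  fix F G H :: L2 and a b :: real
  show "F + G + H = F + (G + H)"
    by transfer (auto simp: L2_eq_def sq_integrable_add add.assoc)
  show "F + G = G + F"
    by transfer (auto simp: L2_eq_def sq_integrable_add add.commute)
  show "0 + F = F" by transfer simp
  show "- F + F = 0" by transfer (simp add: L2_eq_def sq_integrable_zero)
  show "F - G = F + - G" by (rule minus_L2_def)
  show "a *\<^sub>R (F + G) = a *\<^sub>R F + a *\<^sub>R G"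
    by transfer (auto simp: L2_eq_def sq_integrable_add sq_integrable_mult_left distrib_left)
  show "(a + b) *\<^sub>R F = a *\<^sub>R F + b *\<^sub>R F"
    by transfer (auto simp: L2_eq_def distrib_right sq_integrable_add sq_integrable_mult_left
      simp flip: distrib_right)
  show "a *\<^sub>R b *\<^sub>R F = (a * b) *\<^sub>R F"
    by transfer (auto simp: L2_eq_def sq_integrable_mult_left mult.assoc simp flip: of_real_mult)
  show "1 *\<^sub>R F = F" by transfer simp
  show "dist F G = norm (F - G)" by (rule dist_L2_def)
  show "sgn F = inverse (norm F) *\<^sub>R F" by (rule sgn_L2_def)
  show "uniformity = (INF e\<in>{0<..}. principal {(F, G :: L2). dist F G < e})"
    by (rule uniformity_L2_def)
  show "open U = (\<forall>F\<in>U. \<forall>\<^sub>F (F', G) in uniformity. F' = F \<longrightarrow> G \<in> U)" for U :: "L2 set"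
    by (rule open_L2_def)
  show "norm F = 0 \<longleftrightarrow> F = 0"
    by transfer (auto simp: L2_eq_def L2_seminorm_eq_0_iff sq_integrable_zero)
  show "norm (F + G) \<le> norm F + norm G"
    by transfer (auto simp: L2_eq_def L2_seminorm_triangle)
  show "norm (a *\<^sub>R F) = \<bar>a\<bar> * norm F"
    by transfer (simp add: L2_seminorm_mult)
qed

end

lift_definition scaleC_L2 :: "complex \<Rightarrow> L2 \<Rightarrow> L2" (infixr \<open>*\<^sub>C\<close> 75) is "\<lambda>c f x. c * f x"
  by (auto simp: L2_eq_def sq_integrable_mult_left elim!: AE_mp)

interpretation L2: vector_space scaleC_L2
proof
  fix F G :: L2 and a b :: complex
  show "a *\<^sub>C (F + G) = a *\<^sub>C F + a *\<^sub>C G"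
    by transfer (auto simp: L2_eq_def sq_integrable_add sq_integrable_mult_left distrib_left)
  show "(a + b) *\<^sub>C F = a *\<^sub>C F + b *\<^sub>C F"
    by transfer (auto simp: L2_eq_def distrib_right sq_integrable_add sq_integrable_mult_left
      simp flip: distrib_right)
  show "a *\<^sub>C b *\<^sub>C F = (a * b) *\<^sub>C F"
    by transfer (auto simp: L2_eq_def sq_integrable_mult_left mult.assoc)
  show "1 *\<^sub>C F = F" by transfer simp
qed


section \<open>Absolutely continuous functions\<close>

definition abs_continuous01 :: "(real \<Rightarrow> complex) \<Rightarrow> bool" where
  "abs_continuous01 y \<longleftrightarrow>
     (\<forall>\<epsilon>>0. \<exists>\<delta>>0. \<forall>D :: (real \<times> real) set.
        finite D \<and> (\<forall>(s, t)\<in>D. 0 \<le> s \<and> s \<le> t \<and> t \<le> 1) \<and>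
        disjoint_family_on (\<lambda>(s, t). {s<..<t}) D \<and>
        (\<Sum>(s, t)\<in>D. t - s) < \<delta>
        \<longrightarrow> (\<Sum>(s, t)\<in>D. norm (y t - y s)) < \<epsilon>)"

definition has_ae_derivative :: "(real \<Rightarrow> complex) \<Rightarrow> (real \<Rightarrow> complex) \<Rightarrow> bool" where
  "has_ae_derivative y y' \<longleftrightarrow> (AE x in leb01. (y has_vector_derivative y' x) (at x))"


section \<open>The Sturm--Liouville operator with singular potential\<close>

text \<open>Functions are determined only up to null sets here: \<open>u\<close> is the absolutely continuous
  representative of the quasi-derivative $y' - ry$, and it is this representative that
  has to be differentiated in the expression $\ell(y)$.\<close>

definition has_quasi_derivative ::
    "(real \<Rightarrow> real) \<Rightarrow> (real \<Rightarrow> complex) \<Rightarrow> (real \<Rightarrow> complex) \<Rightarrow> bool" where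
  "has_quasi_derivative r y u \<longleftrightarrow>
     abs_continuous01 y \<and> abs_continuous01 u \<and>
     (\<exists>y'. has_ae_derivative y y' \<and> (AE x in leb01. u x = y' x - of_real (r x) * y x))"

text \<open>\<open>ell_graph r y f\<close>: \<open>y\<close> lies in the domain of the differential expression \<open>\<ell>\<close>
  and \<open>\<ell>(y) = f\<close> almost everywhere. Only \<open>r\<close> enters; it encodes the
  distributional potential $q = r'$.\<close>

definition ell_graph ::
    "(real \<Rightarrow> real) \<Rightarrow> (real \<Rightarrow> complex) \<Rightarrow> (real \<Rightarrow> complex) \<Rightarrow> bool" where
  "ell_graph r y f \<longleftrightarrow>
     (\<exists>u u'. has_quasi_derivative r y u \<and> has_ae_derivative u u' \<and> sq_integrable f \<and>
        (AE x in leb01. f x = - u' x - of_real (r x) * u x - of_real ((r x)\<^sup>2) * y x))"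

definition graph_A :: "(real \<Rightarrow> real) \<Rightarrow> (L2 \<times> L2) set" where
  "graph_A r = {(abs_L2 y, abs_L2 f) | y f. ell_graph r y f \<and> y 0 = 0 \<and> y 1 = 0}"

definition dom_A :: "(real \<Rightarrow> real) \<Rightarrow> L2 set" where
  "dom_A r = Domain (graph_A r)"

definition op_A :: "(real \<Rightarrow> real) \<Rightarrow> L2 \<Rightarrow> L2" where
  "op_A r Y = (THE F. (Y, F) \<in> graph_A r)"

text \<open>Meaningful for those \<open>Y\<close> with \<open>2pY\<close> in $L_2$, in particular on \<open>dom_A r\<close>.\<close>

definition op_B :: "(real \<Rightarrow> real) \<Rightarrow> L2 \<Rightarrow> L2" where
  "op_B p Y = abs_L2 (\<lambda>x. of_real (2 * p x) * rep_L2 Y x)"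

definition pencil_T :: "(real \<Rightarrow> real) \<Rightarrow> (real \<Rightarrow> real) \<Rightarrow> complex \<Rightarrow> L2 \<Rightarrow> L2" where
  "pencil_T p r \<mu> Y = \<mu>\<^sup>2 *\<^sub>C Y - \<mu> *\<^sub>C op_B p Y - op_A r Y"


section \<open>Spectra of operators and of operator pencils\<close>

text \<open>A possibly unbounded operator is given by its domain \<open>D\<close> and a function that is
  relevant on \<open>D\<close> only.\<close>

definition boundedly_invertible :: "L2 set \<Rightarrow> (L2 \<Rightarrow> L2) \<Rightarrow> bool" where
  "boundedly_invertible D S \<longleftrightarrow> bij_betw S D UNIV \<and> bounded_linear (inv_into D S)"

definition op_spectrum :: "L2 set \<Rightarrow> (L2 \<Rightarrow> L2) \<Rightarrow> complex set" where
  "op_spectrum D S = {\<mu>. \<not> boundedly_invertible D (\<lambda>Y. S Y - \<mu> *\<^sub>C Y)}"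

definition pencil_spectrum :: "L2 set \<Rightarrow> (complex \<Rightarrow> L2 \<Rightarrow> L2) \<Rightarrow> complex set" where
  "pencil_spectrum D T = {\<mu>. 0 \<in> op_spectrum D (T \<mu>)}"

definition null_space :: "L2 set \<Rightarrow> (L2 \<Rightarrow> L2) \<Rightarrow> L2 set" where
  "null_space D S = {Y \<in> D. S Y = 0}"

definition pencil_eigenvalue :: "L2 set \<Rightarrow> (complex \<Rightarrow> L2 \<Rightarrow> L2) \<Rightarrow> complex \<Rightarrow> bool" where
  "pencil_eigenvalue D T \<mu> \<longleftrightarrow> (\<exists>Y\<in>D. Y \<noteq> 0 \<and> T \<mu> Y = 0)"

definition geometrically_simple :: "L2 set \<Rightarrow> (complex \<Rightarrow> L2 \<Rightarrow> L2) \<Rightarrow> complex \<Rightarrow> bool" where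
  "geometrically_simple D T \<mu> \<longleftrightarrow> L2.dim (null_space D (T \<mu>)) = 1"

end

(* The equation T(mu) y = g is a first order linear system with integrable coefficients for the
   pair of y and its quasi-derivative u = y' - r y. Its Caratheodory solutions exist, are unique
   and satisfy a Gronwall bound, and the solution with y(0) = 0, u(0) = 1 depends on mu in a
   complex differentiable way. Hence d(mu) = y(1) is entire. If d(mu) is nonzero, the boundary
   value problem is uniquely solvable with a bounded solution operator; if d(mu) = 0, the solution
   above spans the null space. So the spectrum is the zero set of d, and it remains to see that d
   does not vanish identically. For mu = i tau with tau large this follows from an energy
   argument: if v' + 2 r v = r^2, then Re (u cnj y) + v |y|^2 has derivative
   |u|^2 + tau^2 |y|^2 + 2 v Re (u cnj y) >= (tau^2 - v^2) |y|^2 and vanishes at both end points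
   whenever d(mu) = 0. *)

theory Submission
  imports Defs "HOL-Complex_Analysis.Conformal_Mappings"
begin

text \<open>The coefficients \<open>r\<close>, \<open>r\<^sup>2\<close> and \<open>p\<close> are
  merely integrable, so solutions satisfy the system only almost everywhere; passing to the pair (y,
  u) is what removes the distribution q = r'. The domain of A is described by epsilon-delta absolute
  continuity and derivatives almost everywhere, whereas Picard iteration and Gronwall work with
  integral equations. Translating between the two takes both halves of the fundamental theorem of
  calculus for absolutely continuous functions.

  The choice mu = i tau is dictated by p: since p is real, 2 mu p |y|^2 is purely imaginary and
  drops out of Re (u cnj y)'. What remains is |u|^2 + tau^2 |y|^2 - r^2 |y|^2. As r^2 may be
  unbounded, no tau need dominate it pointwise. The multiplier v is found by differentiating v
  |y|^2, which gives (v' + 2 r v) |y|^2 + 2 v Re (u cnj y): the equation for v makes the first term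
  cancel the r^2 term, at the price of a term whose coefficient v is continuous, hence
  bounded.\<close>

section \<open>Absolutely continuous functions\<close>

text \<open>Values in an arbitrary normed space: pairs (y, u), the real multiplier v and the real
  energy are handled by the same calculus as complex functions.\<close>

definition abs_cont :: "(real \<Rightarrow> 'a::real_normed_vector) \<Rightarrow> bool" where
  "abs_cont y \<longleftrightarrow>
     (\<forall>\<epsilon>>0. \<exists>\<delta>>0. \<forall>D :: (real \<times> real) set.
        finite D \<and> (\<forall>(s, t)\<in>D. 0 \<le> s \<and> s \<le> t \<and> t \<le> 1) \<and>
        disjoint_family_on (\<lambda>(s, t). {s<..<t}) D \<and>
        (\<Sum>(s, t)\<in>D. t - s) < \<delta>
        \<longrightarrow> (\<Sum>(s, t)\<in>D. norm (y t - y s)) < \<epsilon>)"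

lemma abs_continuous01_iff: "abs_continuous01 y \<longleftrightarrow> abs_cont y"
  by (simp add: abs_continuous01_def abs_cont_def)

lemma abs_contD:
  assumes "abs_cont y" "\<epsilon> > 0"
  obtains \<delta> where "\<delta> > 0"
    "\<And>D. \<lbrakk>finite D; \<And>s t. (s, t) \<in> D \<Longrightarrow> 0 \<le> s \<and> s \<le> t \<and> t \<le> 1;
        disjoint_family_on (\<lambda>(s, t). {s<..<t}) D; (\<Sum>(s, t)\<in>D. t - s) < \<delta>\<rbrakk>
      \<Longrightarrow> (\<Sum>(s, t)\<in>D. norm (y t - y s)) < \<epsilon>"
proof -
  obtain \<delta> where "\<delta> > 0" and \<delta>: "\<forall>D. finite D \<and> (\<forall>(s, t)\<in>D. 0 \<le> s \<and> s \<le> t \<and> t \<le> 1) \<and>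
        disjoint_family_on (\<lambda>(s, t). {s<..<t}) D \<and> (\<Sum>(s, t)\<in>D. t - s) < \<delta>
        \<longrightarrow> (\<Sum>(s, t)\<in>D. norm (y t - y s)) < \<epsilon>"
    using assms unfolding abs_cont_def by meson
  have "(\<Sum>(s, t)\<in>D. norm (y t - y s)) < \<epsilon>"
    if "finite D" "\<And>s t. (s, t) \<in> D \<Longrightarrow> 0 \<le> s \<and> s \<le> t \<and> t \<le> 1"
      "disjoint_family_on (\<lambda>(s, t). {s<..<t}) D" "(\<Sum>(s, t)\<in>D. t - s) < \<delta>" for D
    using \<delta>[rule_format, of D] that by blast
  then show thesis using that \<open>\<delta> > 0\<close> by blast
qed

lemma abs_contI:
  assumes "\<And>\<epsilon>. \<epsilon> > 0 \<Longrightarrow> \<exists>\<delta>>0. \<forall>D. finite D \<longrightarrow> (\<forall>s t. (s, t) \<in> D \<longrightarrow> 0 \<le> s \<and> s \<le> t \<and> t \<le> 1) \<longrightarrow>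
      disjoint_family_on (\<lambda>(s, t). {s<..<t}) D \<longrightarrow> (\<Sum>(s, t)\<in>D. t - s) < \<delta> \<longrightarrow>
      (\<Sum>(s, t)\<in>D. norm (y t - y s)) < \<epsilon>"
  shows "abs_cont y"
  unfolding abs_cont_def
proof (intro allI impI)
  fix \<epsilon> :: real assume "\<epsilon> > 0"
  from assms[OF this] obtain \<delta> where "\<delta> > 0" and d: "\<forall>D. finite D \<longrightarrow> (\<forall>s t. (s, t) \<in> D \<longrightarrow> 0 \<le> s \<and> s \<le> t \<and> t \<le> 1) \<longrightarrow>
      disjoint_family_on (\<lambda>(s, t). {s<..<t}) D \<longrightarrow> (\<Sum>(s, t)\<in>D. t - s) < \<delta> \<longrightarrow>
      (\<Sum>(s, t)\<in>D. norm (y t - y s)) < \<epsilon>"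
    by blast
  show "\<exists>\<delta>>0. \<forall>D. finite D \<and> (\<forall>(s, t)\<in>D. 0 \<le> s \<and> s \<le> t \<and> t \<le> 1) \<and>
        disjoint_family_on (\<lambda>(s, t). {s<..<t}) D \<and> (\<Sum>(s, t)\<in>D. t - s) < \<delta>
        \<longrightarrow> (\<Sum>(s, t)\<in>D. norm (y t - y s)) < \<epsilon>"
    using \<open>\<delta> > 0\<close> d by (intro exI[of _ \<delta>]) blast
qed

text \<open>Two controlling functions suffice for all later constructions: exponentials of
  primitives, pairs, and quadratic expressions with a multiplier are Lipschitz in their bounded
  ingredients.\<close>

lemma abs_cont_lipschitz:
  assumes f: "abs_cont f" and g: "abs_cont g" and C: "C > 0"
    and w: "\<And>s t. \<lbrakk>0 \<le> s; s \<le> t; t \<le> 1\<rbrakk> \<Longrightarrow>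
      norm (w t - w s) \<le> C * (norm (f t - f s) + norm (g t - g s))"
  shows "abs_cont w"
proof (rule abs_contI)
  fix \<epsilon> :: real assume "\<epsilon> > 0"
  then have e: "\<epsilon> / (2 * C) > 0" using C by simp
  obtain d1 where d1: "d1 > 0" "\<And>D. \<lbrakk>finite D; \<And>s t. (s, t) \<in> D \<Longrightarrow> 0 \<le> s \<and> s \<le> t \<and> t \<le> 1;
        disjoint_family_on (\<lambda>(s, t). {s<..<t}) D; (\<Sum>(s, t)\<in>D. t - s) < d1\<rbrakk>
      \<Longrightarrow> (\<Sum>(s, t)\<in>D. norm (f t - f s)) < \<epsilon> / (2 * C)"
    using abs_contD[OF f e] by blast
  obtain d2 where d2: "d2 > 0" "\<And>D. \<lbrakk>finite D; \<And>s t. (s, t) \<in> D \<Longrightarrow> 0 \<le> s \<and> s \<le> t \<and> t \<le> 1;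
        disjoint_family_on (\<lambda>(s, t). {s<..<t}) D; (\<Sum>(s, t)\<in>D. t - s) < d2\<rbrakk>
      \<Longrightarrow> (\<Sum>(s, t)\<in>D. norm (g t - g s)) < \<epsilon> / (2 * C)"
    using abs_contD[OF g e] by blast
  have "(\<Sum>(s, t)\<in>D. norm (w t - w s)) < \<epsilon>"
    if D: "finite D" "\<And>s t. (s, t) \<in> D \<Longrightarrow> 0 \<le> s \<and> s \<le> t \<and> t \<le> 1"
      "disjoint_family_on (\<lambda>(s, t). {s<..<t}) D" "(\<Sum>(s, t)\<in>D. t - s) < min d1 d2" for D
  proof -
    have "(\<Sum>(s, t)\<in>D. norm (w t - w s)) \<le> (\<Sum>(s, t)\<in>D. C * (norm (f t - f s) + norm (g t - g s)))"
      using D(2) w by (intro sum_mono) auto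
    also have "\<dots> = C * ((\<Sum>(s, t)\<in>D. norm (f t - f s)) + (\<Sum>(s, t)\<in>D. norm (g t - g s)))"
      by (simp add: sum_distrib_left case_prod_unfold flip: sum.distrib)
    also have "\<dots> < C * (\<epsilon> / (2 * C) + \<epsilon> / (2 * C))"
      using d1(2)[OF D(1,2,3)] d2(2)[OF D(1,2,3)] D(4) C
      by (intro mult_strict_left_mono add_strict_mono) auto
    also have "\<dots> = \<epsilon>" using C by (simp add: field_simps)
    finally show ?thesis .
  qed
  then show "\<exists>\<delta>>0. \<forall>D. finite D \<longrightarrow> (\<forall>s t. (s, t) \<in> D \<longrightarrow> 0 \<le> s \<and> s \<le> t \<and> t \<le> 1) \<longrightarrow>
      disjoint_family_on (\<lambda>(s, t). {s<..<t}) D \<longrightarrow> (\<Sum>(s, t)\<in>D. t - s) < \<delta> \<longrightarrow>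
      (\<Sum>(s, t)\<in>D. norm (w t - w s)) < \<epsilon>"
    using d1(1) d2(1) by (intro exI[of _ "min d1 d2"]) auto
qed

lemma abs_cont_continuous:
  assumes "abs_cont f" shows "continuous_on {0..1} f"
  unfolding continuous_on_iff
proof (intro ballI allI impI)
  fix x e :: real assume x: "x \<in> {0..1}" and e: "e > 0"
  obtain d where d: "d > 0" "\<And>D. \<lbrakk>finite D; \<And>s t. (s, t) \<in> D \<Longrightarrow> 0 \<le> s \<and> s \<le> t \<and> t \<le> 1;
        disjoint_family_on (\<lambda>(s, t). {s<..<t}) D; (\<Sum>(s, t)\<in>D. t - s) < d\<rbrakk>
      \<Longrightarrow> (\<Sum>(s, t)\<in>D. norm (f t - f s)) < e"
    using abs_contD[OF assms e] by blast
  have "dist (f z) (f x) < e" if "z \<in> {0..1}" "dist z x < d" for z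
  proof (cases "z \<le> x")
    case True
    show ?thesis
      using d(2)[of "{(z, x)}"] True that x
      by (auto simp: disjoint_family_on_def dist_norm norm_minus_commute)
  next
    case False
    show ?thesis
      using d(2)[of "{(x, z)}"] False that x
      by (auto simp: disjoint_family_on_def dist_norm norm_minus_commute)
  qed
  then show "\<exists>d>0. \<forall>x'\<in>{0..1}. dist x' x < d \<longrightarrow> dist (f x') (f x) < e"
    using d(1) by blast
qed

text \<open>The tags in the exceptional set carry intervals inside an open set of small measure, so
  absolute continuity makes their contribution to the Riemann sum negligible.\<close>

theorem fundamental_theorem_of_calculus_abs_cont:
  fixes y :: "real \<Rightarrow> 'a::euclidean_space"
  assumes y: "abs_cont y" and N: "negligible N" and b: "0 \<le> b" "b \<le> 1"
    and der: "\<And>x. x \<in> {0..1} - N \<Longrightarrow> (y has_vector_derivative g x) (at x within {0..1})"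
  shows "(g has_integral (y b - y 0)) {0..b}"
proof -
  \<comment> \<open>On \<open>N\<close> nothing is known about \<open>g\<close>. With the value 0
    there, a tag in \<open>N\<close> contributes only an increment of \<open>y\<close> to the error,
    and the integral is the same.\<close>
  define h where "h x = (if x \<in> N then 0 else g x)" for x
  have "(h has_integral (y b - y 0)) {0..b}"
    unfolding has_integral_real
  proof (intro allI impI)
    fix e :: real assume e: "e > 0"
    then have e2: "e / 2 > 0" by simp
    obtain \<delta> where d: "\<delta> > 0" "\<And>D. \<lbrakk>finite D; \<And>s t. (s, t) \<in> D \<Longrightarrow> 0 \<le> s \<and> s \<le> t \<and> t \<le> 1;
        disjoint_family_on (\<lambda>(s, t). {s<..<t}) D; (\<Sum>(s, t)\<in>D. t - s) < \<delta>\<rbrakk>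
      \<Longrightarrow> (\<Sum>(s, t)\<in>D. norm (y t - y s)) < e / 2"
      using abs_contD[OF y e2] by blast
    obtain O' where O: "open O'" "N \<subseteq> O'" "O' - N \<in> lmeasurable" "emeasure lebesgue (O' - N) < ennreal \<delta>"
      using sets_lebesgue_outer_open[OF negligible_imp_sets[OF N] d(1)] by metis
    have Om: "O' \<in> lmeasurable" "measure lebesgue O' < \<delta>"
    proof -
      have eq: "O' = (O' - N) \<union> N" using O by auto
      show "O' \<in> lmeasurable"
        using O(3) negligible_imp_measurable[OF N] by (subst eq) (rule fmeasurable.Un)
      have "measure lebesgue O' \<le> measure lebesgue (O' - N) + measure lebesgue N"
        using O(3) negligible_imp_measurable[OF N]
        by (subst eq) (intro measure_Un_le; auto)
      also have "\<dots> < \<delta>" using O(3,4) negligible_imp_measure0[OF N] d(1)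
        by (simp add: emeasure_eq_measure2 ennreal_less_iff)
      finally show "measure lebesgue O' < \<delta>" .
    qed
    have "\<exists>d>0. \<forall>z\<in>{0..1}. \<bar>z - x\<bar> < d \<longrightarrow>
        norm (y z - y x - (z - x) *\<^sub>R g x) \<le> (e / 2) * \<bar>z - x\<bar>" if "x \<in> {0..1} - N" for x
      using der[OF that] e2
      unfolding has_vector_derivative_def has_derivative_within_alt real_norm_def by blast
    then obtain \<rho> where \<rho>: "\<And>x. x \<in> {0..1} - N \<Longrightarrow> \<rho> x > 0"
      "\<And>x z. \<lbrakk>x \<in> {0..1} - N; z \<in> {0..1}; \<bar>z - x\<bar> < \<rho> x\<rbrakk>
        \<Longrightarrow> norm (y z - y x - (z - x) *\<^sub>R g x) \<le> (e / 2) * \<bar>z - x\<bar>"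
      by metis
    \<comment> \<open>The radius 1 is a mere default: a gauge must be defined at every real, but the
      tags of a division of {0..b} lie in {0..1}.\<close>
    define \<gamma> where "\<gamma> x = (if x \<in> N then O' else if x \<in> {0..1} then ball x (\<rho> x) else ball x 1)" for x
    have \<gamma>: "gauge \<gamma>" using O \<rho>(1) by (auto simp: gauge_def \<gamma>_def)
    have "norm ((\<Sum>(x, K)\<in>D. measure lborel K *\<^sub>R h x) - (y b - y 0)) < e"
      if D: "D tagged_division_of {0..b}" "\<gamma> fine D" for D
    proof -
      note Dp = tagged_division_ofD[OF D(1)]
      have fin: "finite D" by (rule Dp(1))
      have K: "\<exists>s t. K = {s..t} \<and> s \<le> x \<and> x \<le> t \<and> 0 \<le> s \<and> t \<le> b \<and> Inf K = s \<and> Sup K = t \<and> measure lborel K = t - s"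
        if "(x, K) \<in> D" for x K
      proof -
        obtain s t where "K = {s..t}" using Dp(4)[OF \<open>(x, K) \<in> D\<close>] by auto
        moreover have "x \<in> K" "K \<subseteq> {0..b}" using Dp(2,3)[OF that] by auto
        ultimately show ?thesis by (intro exI[of _ s] exI[of _ t]) (auto simp: subset_eq)
      qed
      define E where "E = {(x, K) \<in> D. x \<in> N}"
      have tel: "(\<Sum>(x, K)\<in>D. y (Sup K) - y (Inf K)) = y b - y 0"
        using additive_tagged_division_1[OF b(1) D(1), of y] by simp
      define err where "err = (\<lambda>(x, K). measure lborel K *\<^sub>R h x - (y (Sup K) - y (Inf K)))"
      have "norm ((\<Sum>(x, K)\<in>D. measure lborel K *\<^sub>R h x) - (y b - y 0)) = norm (\<Sum>p\<in>D. err p)"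
        unfolding tel[symmetric] err_def by (simp add: case_prod_unfold sum_subtractf)
      also have "\<dots> \<le> (\<Sum>p\<in>D. norm (err p))" by (rule norm_sum)
      also have "\<dots> = (\<Sum>p\<in>D - E. norm (err p)) + (\<Sum>p\<in>E. norm (err p))"
        using fin by (intro sum.subset_diff) (auto simp: E_def)
      \<comment> \<open>Tags outside \<open>N\<close> cost e / 2 per unit length by
        differentiability, those in \<open>N\<close> less than e / 2 in total; b \<le> 1 closes the
        budget.\<close>
      also have "\<dots> < e / 2 * b + e / 2"
      proof (rule add_le_less_mono)
        have "(\<Sum>p\<in>D - E. norm (err p)) \<le> (\<Sum>(x, K)\<in>D - E. e / 2 * measure lborel K)"
        proof (rule sum_mono, clarify)
          fix x K assume xK: "(x, K) \<in> D" "(x, K) \<notin> E"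
          then have xN: "x \<notin> N" by (auto simp: E_def)
          obtain s t where st: "K = {s..t}" "s \<le> x" "x \<le> t" "0 \<le> s" "t \<le> b" "Inf K = s" "Sup K = t" "measure lborel K = t - s"
            using K[OF xK(1)] by blast
          have x01: "x \<in> {0..1} - N" using st xN b by auto
          have "K \<subseteq> ball x (\<rho> x)" using fineD[OF D(2) xK(1)] x01 by (simp add: \<gamma>_def)
          moreover have "s \<in> K" "t \<in> K" using st by auto
          ultimately have "s \<in> ball x (\<rho> x)" "t \<in> ball x (\<rho> x)" by blast+
          then have *: "norm (y t - y x - (t - x) *\<^sub>R g x) \<le> e / 2 * \<bar>t - x\<bar>"
            "norm (y s - y x - (s - x) *\<^sub>R g x) \<le> e / 2 * \<bar>s - x\<bar>"
            using \<rho>(2)[OF x01, of t] \<rho>(2)[OF x01, of s] st b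
            by (auto simp: dist_real_def abs_minus_commute)
          have "err (x, K) = (y s - y x - (s - x) *\<^sub>R g x) - (y t - y x - (t - x) *\<^sub>R g x)"
            using st xN by (simp add: err_def h_def algebra_simps)
          then have "norm (err (x, K)) \<le> e / 2 * \<bar>s - x\<bar> + e / 2 * \<bar>t - x\<bar>"
            using * norm_triangle_ineq4[of "y s - y x - (s - x) *\<^sub>R g x" "y t - y x - (t - x) *\<^sub>R g x"]
            by simp
          also have "\<dots> = e / 2 * measure lborel K" using st by (simp add: field_simps)
          finally show "norm (err (x, K)) \<le> e / 2 * measure lborel K" .
        qed
        also have "\<dots> \<le> (\<Sum>(x, K)\<in>D. e / 2 * measure lborel K)"
          using fin e by (intro sum_mono2) auto
        also have "\<dots> = e / 2 * (\<Sum>(x, K)\<in>D. measure lborel K)" by (simp add: sum_distrib_left case_prod_unfold)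
        also have "(\<Sum>(x, K)\<in>D. measure lborel K) = b"
          using additive_content_tagged_division[of D 0 b] D(1) b by simp
        finally show "(\<Sum>p\<in>D - E. norm (err p)) \<le> e / 2 * b" .
      next
        have Ep: "E tagged_partial_division_of {0..b}"
          using D(1) by (auto simp: tagged_division_of_def E_def intro: tagged_partial_division_subset)
        define S where "S = snd ` E"
        have Sdiv: "S division_of \<Union>S"
          using partial_division_of_tagged_division[OF Ep] by (simp add: S_def)
        have finS: "finite S" using Sdiv by blast
        have SK: "\<exists>s t. K = {s..t} \<and> s \<le> t \<and> 0 \<le> s \<and> t \<le> b \<and> Inf K = s \<and> Sup K = t \<and> measure lebesgue K = t - s
            \<and> interior K = {s<..<t}"
          if "K \<in> S" for K
        proof -
          obtain x where "(x, K) \<in> D" using \<open>K \<in> S\<close> by (auto simp: S_def E_def)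
          from K[OF this] show ?thesis using b
            by (elim exE conjE) (intro exI conjI; simp)
        qed
        define P where "P = (\<lambda>K. (Inf K, Sup K)) ` S"
        have inj: "inj_on (\<lambda>K. (Inf K, Sup K)) S"
        proof (rule inj_onI)
          fix K L assume "K \<in> S" "L \<in> S" "(Inf K, Sup K) = (Inf L, Sup L)"
          then show "K = L" using SK[of K] SK[of L] by auto
        qed
        have "(\<Sum>p\<in>E. norm (err p)) = (\<Sum>(x, K)\<in>E. norm (y (Sup K) - y (Inf K)))"
          by (intro sum.cong) (auto simp: E_def err_def h_def norm_minus_commute)
        also have "\<dots> = sum (\<lambda>K. norm (y (Sup K) - y (Inf K))) S"
          unfolding S_def
        proof (subst sum.reindex_nontrivial)
          show "finite E" using Ep by (rule tagged_partial_division_ofD(1))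
          \<comment> \<open>Two different tags may carry the same interval. Its interior is then
            disjoint from itself, so the interval is a point and its increment is 0; nothing is lost
            when passing from tagged intervals to intervals.\<close>
          fix p q assume pq: "p \<in> E" "q \<in> E" "p \<noteq> q" "snd p = snd q"
          obtain x x' K' where p: "p = (x, K')" "q = (x', K')" using pq by (metis prod.collapse)
          have "interior K' \<inter> interior K' = {}"
            using tagged_partial_division_ofD(5)[OF Ep, of x K' x' K'] pq p by auto
          moreover obtain s t where "K' = {s..t}" "s \<le> t" "Inf K' = s" "Sup K' = t"
            using SK[of K'] pq p by (force simp: S_def)
          ultimately show "norm (y (Sup (snd p)) - y (Inf (snd p))) = 0"
            using p by simp
        qed (simp add: case_prod_unfold)
        also have "\<dots> = (\<Sum>(s, t)\<in>P. norm (y t - y s))"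
          unfolding P_def by (subst sum.reindex[OF inj]) (simp add: o_def)
        also have "\<dots> < e / 2"
        proof (rule d(2))
          show "finite P" using finS by (simp add: P_def)
          show "0 \<le> s \<and> s \<le> t \<and> t \<le> 1" if "(s, t) \<in> P" for s t
          proof -
            obtain K where "K \<in> S" "s = Inf K" "t = Sup K" using \<open>(s, t) \<in> P\<close> by (auto simp: P_def)
            then show ?thesis using SK[of K] b by auto
          qed
          show "disjoint_family_on (\<lambda>(s, t). {s<..<t}) P"
            unfolding disjoint_family_on_def
          proof (intro ballI impI)
            fix p q assume "p \<in> P" "q \<in> P" "p \<noteq> q"
            then obtain K L where KL: "K \<in> S" "L \<in> S" "K \<noteq> L" "p = (Inf K, Sup K)" "q = (Inf L, Sup L)"
              unfolding P_def by blast
            then have "interior K \<inter> interior L = {}"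
              using division_ofD(5)[OF Sdiv, of K L] by simp
            moreover have "interior K = {Inf K<..<Sup K}" "interior L = {Inf L<..<Sup L}"
              using SK[OF KL(1)] SK[OF KL(2)] by auto
            ultimately show "(case p of (s, t) \<Rightarrow> {s<..<t}) \<inter> (case q of (s, t) \<Rightarrow> {s<..<t}) = {}"
              using KL by simp
          qed
          have "(\<Sum>(s, t)\<in>P. t - s) = (\<Sum>K\<in>S. measure lebesgue K)"
          proof -
            have "(\<Sum>(s, t)\<in>P. t - s) = (\<Sum>K\<in>S. Sup K - Inf K)"
              unfolding P_def by (subst sum.reindex[OF inj]) (simp add: o_def)
            also have "\<dots> = (\<Sum>K\<in>S. measure lebesgue K)"
            proof (rule sum.cong)
              fix K assume "K \<in> S"
              then show "Sup K - Inf K = measure lebesgue K" using SK[of K] by auto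
            qed simp
            finally show ?thesis .
          qed
          also have "\<dots> = measure lebesgue (\<Union>S)" by (rule content_division[OF Sdiv])
          also have "\<dots> \<le> measure lebesgue O'"
          proof (rule measure_mono_fmeasurable[OF _ _ Om(1)])
            show "\<Union>S \<subseteq> O'"
            proof clarsimp
              fix z K assume "z \<in> K" "K \<in> S"
              then obtain x where x: "(x, K) \<in> D" "x \<in> N" by (auto simp: S_def E_def)
              then show "z \<in> O'" using fineD[OF D(2) x(1)] \<open>z \<in> K\<close> by (auto simp: \<gamma>_def)
            qed
            show "\<Union>S \<in> sets lebesgue" using lmeasurable_division[OF Sdiv] by blast
          qed
          also have "\<dots> < \<delta>" by (rule Om(2))
          finally show "(\<Sum>(s, t)\<in>P. t - s) < \<delta>" .
        qed
        finally show "(\<Sum>p\<in>E. norm (err p)) < e / 2" .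
      qed
      also have "\<dots> \<le> e" using b e by (simp add: field_simps)
      finally show ?thesis .
    qed
    then show "\<exists>\<gamma>. gauge \<gamma> \<and> (\<forall>D. D tagged_division_of {0..b} \<and> \<gamma> fine D \<longrightarrow>
        norm ((\<Sum>(x, k)\<in>D. measure lborel k *\<^sub>R h x) - (y b - y 0)) < e)"
      using \<gamma> by blast
  qed
  then show ?thesis
    by (rule has_integral_spike[OF N, rotated]) (auto simp: h_def)
qed

section \<open>Primitives of integrable functions\<close>

text \<open>At a point of \<open>Bad c\<close> there are arbitrarily short intervals on which the
  Riemann term misses the integral by more than c times the length. Vitali's theorem selects
  disjoint ones that cover almost all of \<open>Bad c\<close>, and Henstock's lemma bounds the sum
  of the misses, hence c times the total length.\<close>

theorem lebesgue_differentiation: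
  fixes f :: "real \<Rightarrow> 'a::euclidean_space"
  assumes f: "f integrable_on {a..b}"
  shows "negligible {x \<in> {a..b}.
      \<not> ((\<lambda>x. integral {a..x} f) has_vector_derivative f x) (at x within {a..b})}"
proof -
  define F where "F x = integral {a..x} f" for x
  define R where "R x z = norm (F z - F x - (z - x) *\<^sub>R f x)" for x z
  \<comment> \<open>The closed interval between x and z in either order, written as a ball because
    the covering theorem speaks of balls.\<close>
  define I where "I = (\<lambda>(x, z). cball ((x + z) / 2) (\<bar>z - x\<bar> / 2 :: real))"
  have I: "I (x, z) = {min x z..max x z}" for x z
    by (auto simp: I_def cball_eq_atLeastAtMost min_def max_def field_simps)
  have RI: "R x z = norm (measure lborel (I (x, z)) *\<^sub>R f x - integral (I (x, z)) f)"
    if "x \<in> {a..b}" "z \<in> {a..b}" for x z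
  proof (cases "x \<le> z")
    case True
    have "F x + integral {x..z} f = F z" unfolding F_def
      using that True
      by (intro Henstock_Kurzweil_Integration.integral_combine integrable_on_subinterval[OF f]) auto
    then have "F z - F x = integral {x..z} f" by (simp add: algebra_simps)
    then show ?thesis using True by (simp add: R_def I norm_minus_commute)
  next
    case False
    have "F z + integral {z..x} f = F x" unfolding F_def
      using that False
      by (intro Henstock_Kurzweil_Integration.integral_combine integrable_on_subinterval[OF f]) auto
    then have "F z - F x = - integral {z..x} f" by (simp add: algebra_simps)
    then have "F z - F x - (z - x) *\<^sub>R f x = (x - z) *\<^sub>R f x - integral {z..x} f"
      by (simp add: algebra_simps)
    then show ?thesis using False by (simp add: R_def I)
  qed
  define Bad where "Bad c = {x \<in> {a..b}. \<forall>d>0. \<exists>z\<in>{a..b}. \<bar>z - x\<bar> < d \<and> c * \<bar>z - x\<bar> < R x z}" for c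
  have neg: "negligible (Bad c)" if c: "c > 0" for c
    unfolding negligible_outer_le
  proof (intro allI impI)
    fix e :: real assume e: "e > 0"
    \<comment> \<open>With the tolerance e * c in Henstock's lemma, division by c leaves total
      length at most e.\<close>
    have "e * c > 0" using e c by simp
    from Henstock_lemma[of f a b, OF _ this] f
    obtain \<gamma> where \<gamma>: "gauge \<gamma>" and hen: "\<And>p. \<lbrakk>p tagged_partial_division_of {a..b}; \<gamma> fine p\<rbrakk> \<Longrightarrow>
        (\<Sum>(x, k)\<in>p. norm (measure lborel k *\<^sub>R f x - integral k f)) < e * c"
      by (auto simp del: box_real simp: box_real(2)[symmetric])
    define K where "K = {(x, z). x \<in> Bad c \<and> z \<in> {a..b} \<and> I (x, z) \<subseteq> \<gamma> x \<and> c * \<bar>z - x\<bar> < R x z}"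
    have Kne: "x \<noteq> z" if "(x, z) \<in> K" for x z
      using that by (auto simp: K_def R_def)
    have vit: "\<exists>i. i \<in> K \<and> x \<in> cball ((fst i + snd i) / 2) (\<bar>snd i - fst i\<bar> / 2) \<and> \<bar>snd i - fst i\<bar> / 2 < d"
      if "x \<in> Bad c" "d > 0" for x d
    proof -
      obtain \<rho> where \<rho>: "\<rho> > 0" "ball x \<rho> \<subseteq> \<gamma> x"
        using \<gamma> by (meson gauge_def open_contains_ball)
      obtain z where z: "z \<in> {a..b}" "\<bar>z - x\<bar> < min d \<rho>" "c * \<bar>z - x\<bar> < R x z"
      proof -
        have "\<forall>d>0. \<exists>z\<in>{a..b}. \<bar>z - x\<bar> < d \<and> c * \<bar>z - x\<bar> < R x z"
          using \<open>x \<in> Bad c\<close> by (simp add: Bad_def)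
        moreover have "min d \<rho> > 0" using \<open>d > 0\<close> \<rho>(1) by simp
        ultimately show thesis using that by blast
      qed
      have "I (x, z) \<subseteq> ball x \<rho>" using z(2) by (auto simp: I dist_real_def min_def max_def split: if_splits)
      then have "(x, z) \<in> K" using that z \<rho> by (auto simp: K_def)
      moreover have "x \<in> I (x, z)" by (auto simp: I)
      ultimately show ?thesis using z(2) that(2) by (intro exI[of _ "(x, z)"]) (auto simp: I_def)
    qed
    obtain C where C: "countable C" "C \<subseteq> K"
      "pairwise (\<lambda>i j. disjnt (cball ((fst i + snd i) / 2) (\<bar>snd i - fst i\<bar> / 2))
          (cball ((fst j + snd j) / 2) (\<bar>snd j - fst j\<bar> / 2))) C"
      "negligible (Bad c - (\<Union>i\<in>C. cball ((fst i + snd i) / 2) (\<bar>snd i - fst i\<bar> / 2)))"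
      by (rule Vitali_covering_theorem_cballs[of K "\<lambda>i. \<bar>snd i - fst i\<bar> / 2" "Bad c" "\<lambda>i. (fst i + snd i) / 2"])
        (use Kne vit in \<open>force+\<close>)
    have Ieq: "cball ((fst i + snd i) / 2) (\<bar>snd i - fst i\<bar> / 2) = I i" for i
      by (simp add: I_def case_prod_unfold)
    note C = C[unfolded Ieq]
    \<comment> \<open>Henstock's lemma concerns finite partial divisions, so finite subfamilies are
      estimated first; the bound does not depend on the subfamily and passes to the countable
      union.\<close>
    have bound: "measure lebesgue (\<Union>i\<in>J. I i) \<le> e" if J: "J \<subseteq> C" "finite J" for J
    proof -
      have JK: "J \<subseteq> K" using J C by auto
      define p where "p = (\<lambda>i. (fst i, I i)) ` J"
      have disj: "I i \<inter> I j = {}" if "i \<in> J" "j \<in> J" "i \<noteq> j" for i j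
        using C(3) that J by (auto simp: pairwise_def disjnt_def)
      have ne: "I i \<noteq> {}" for i by (cases i) (simp add: I)
      have inj: "inj_on (\<lambda>i. (fst i, I i)) J"
        using disj ne by (fastforce simp: inj_on_def)
      have p: "p tagged_partial_division_of {a..b}"
        unfolding tagged_partial_division_of_def
      proof (intro conjI allI impI)
        show "finite p" using J by (simp add: p_def)
        fix x k assume "(x, k) \<in> p"
        then obtain z where xz: "(x, z) \<in> J" "k = I (x, z)" by (auto simp: p_def)
        then have "x \<in> {a..b}" "z \<in> {a..b}" using JK by (auto simp: K_def Bad_def)
        then show "x \<in> k" "k \<subseteq> {a..b}" "\<exists>a b. k = cbox a b" using xz by (auto simp: I intro: exI[of _ "min x z"] exI[of _ "max x z"])
      next
        fix x1 k1 x2 k2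
        assume *: "(x1, k1) \<in> p \<and> (x2, k2) \<in> p \<and> (x1, k1) \<noteq> (x2, k2)"
        then obtain i j where "i \<in> J" "j \<in> J" "k1 = I i" "k2 = I j" "i \<noteq> j" by (auto simp: p_def)
        then show "interior k1 \<inter> interior k2 = {}"
          using disj[of i j] interior_subset[of k1] interior_subset[of k2] by blast
      qed
      have "\<gamma> fine p"
      proof (rule fineI)
        fix x k assume "(x, k) \<in> p"
        then obtain i where i: "i \<in> J" "x = fst i" "k = I i" by (auto simp: p_def)
        with JK have "i \<in> K" by blast
        then show "k \<subseteq> \<gamma> x" using i by (auto simp: K_def)
      qed
      have "c * measure lebesgue (\<Union>i\<in>J. I i) \<le> c * (\<Sum>i\<in>J. measure lebesgue (I i))"
        using J c by (intro mult_left_mono measure_UNION_le) (auto simp: I_def)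
      also have "\<dots> = (\<Sum>i\<in>J. c * \<bar>snd i - fst i\<bar>)"
        unfolding sum_distrib_left
      proof (rule sum.cong)
        fix i assume "i \<in> J"
        show "c * measure lebesgue (I i) = c * \<bar>snd i - fst i\<bar>" by (cases i) (auto simp: I)
      qed simp
      also have "\<dots> \<le> (\<Sum>i\<in>J. R (fst i) (snd i))"
        using JK by (intro sum_mono) (force simp: K_def)
      also have "\<dots> = (\<Sum>i\<in>J. norm (measure lborel (I i) *\<^sub>R f (fst i) - integral (I i) f))"
      proof (rule sum.cong)
        fix i assume "i \<in> J"
        then have "fst i \<in> {a..b}" "snd i \<in> {a..b}" using JK by (auto simp: K_def Bad_def)
        from RI[OF this] show "R (fst i) (snd i) = norm (measure lborel (I i) *\<^sub>R f (fst i) - integral (I i) f)" by simp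
      qed simp
      also have "\<dots> = (\<Sum>(x, k)\<in>p. norm (measure lborel k *\<^sub>R f x - integral k f))"
        unfolding p_def by (subst sum.reindex[OF inj]) (simp add: o_def)
      also have "\<dots> < c * e" using hen[OF p \<open>\<gamma> fine p\<close>] by (simp add: mult.commute)
      finally show ?thesis using c by simp
    qed
    define U where "U = (\<Union>i\<in>C. I i)"
    have Im: "I i \<in> lmeasurable" for i by (simp add: I_def case_prod_unfold)
    have U: "U \<in> lmeasurable" "measure lebesgue U \<le> e"
      unfolding U_def using fmeasurable_UN_bound[OF C(1) Im bound] measure_UN_bound[OF C(1) Im bound] by blast+
    have N: "Bad c - U \<in> lmeasurable" "measure lebesgue (Bad c - U) = 0"
      using C(4) by (auto simp: U_def negligible_imp_measurable negligible_imp_measure0)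
    show "\<exists>T. Bad c \<subseteq> T \<and> T \<in> lmeasurable \<and> measure lebesgue T \<le> e"
    proof (intro exI conjI)
      show "Bad c \<subseteq> U \<union> (Bad c - U)" by blast
      show "U \<union> (Bad c - U) \<in> lmeasurable" using U N by (intro fmeasurable.Un)
      show "measure lebesgue (U \<union> (Bad c - U)) \<le> e"
        using measure_Un_le[of U lebesgue "Bad c - U"] U N fmeasurableD by fastforce
    qed
  qed
  \<comment> \<open>Failure of differentiability means failure for some tolerance, and the
    tolerances 1 / (n + 1) already capture every case.\<close>
  have "{x \<in> {a..b}. \<not> (F has_vector_derivative f x) (at x within {a..b})} \<subseteq> (\<Union>n. Bad (inverse (real (Suc n))))"
  proof clarify
    fix x assume x: "x \<in> {a..b}" and nd: "\<not> (F has_vector_derivative f x) (at x within {a..b})"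
    then obtain e where e: "e > 0" "\<And>d. d > 0 \<Longrightarrow> \<exists>z\<in>{a..b}. \<bar>z - x\<bar> < d \<and> e * \<bar>z - x\<bar> < R x z"
      unfolding has_vector_derivative_def has_derivative_within_alt R_def
      by (auto simp: bounded_linear_scaleR_left not_le)
    obtain n where n: "inverse (real (Suc n)) < e" using reals_Archimedean[OF e(1)] by blast
    have "x \<in> Bad (inverse (real (Suc n)))"
      unfolding Bad_def
    proof (intro CollectI conjI x allI impI)
      fix d :: real assume "d > 0"
      then obtain z where z: "z \<in> {a..b}" "\<bar>z - x\<bar> < d" "e * \<bar>z - x\<bar> < R x z" using e(2) by blast
      have "inverse (real (Suc n)) * \<bar>z - x\<bar> \<le> e * \<bar>z - x\<bar>"
        using n by (intro mult_right_mono) auto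
      then show "\<exists>z\<in>{a..b}. \<bar>z - x\<bar> < d \<and> inverse (real (Suc n)) * \<bar>z - x\<bar> < R x z"
        using z by (intro bexI[of _ z]) auto
    qed
    then show "x \<in> (\<Union>n. Bad (inverse (real (Suc n))))" by blast
  qed
  moreover have "negligible (\<Union>n. Bad (inverse (real (Suc n))))"
    using neg by (intro negligible_countable_Union) auto
  ultimately show ?thesis unfolding F_def by (rule negligible_subset[rotated])
qed

lemma absolutely_integrable_on_sub01:
  fixes u :: "real \<Rightarrow> 'a::euclidean_space"
  assumes "u absolutely_integrable_on {0..1}" "0 \<le> s" "t \<le> 1"
  shows "u absolutely_integrable_on {s..t}" "u integrable_on {s..t}"
proof -
  show "u absolutely_integrable_on {s..t}"
    using assms(2,3) by (intro absolutely_integrable_on_subinterval[OF assms(1)]) auto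
  then show "u integrable_on {s..t}" by (rule set_lebesgue_integral_eq_integral(1))
qed

text \<open>Truncation: |f| is split into min |f| n and a remainder \<open>k\<close>. By dominated
  convergence some n makes the integral of \<open>k\<close> smaller than \<epsilon> / 2, while the
  bounded part contributes at most n times the total length.\<close>

lemma abs_cont_integral:
  fixes f :: "real \<Rightarrow> 'a::euclidean_space"
  assumes f: "f absolutely_integrable_on {0..1}"
  shows "abs_cont (\<lambda>x. integral {0..x} f)"
proof (rule abs_contI)
  fix \<epsilon> :: real assume e: "\<epsilon> > 0"
  define h where "h x = norm (f x)" for x
  define g where "g n x = min (h x) (real n)" for n x
  have h: "h absolutely_integrable_on {0..1}" unfolding h_def by (rule absolutely_integrable_norm[OF f, unfolded o_def])
  have g: "g n absolutely_integrable_on {0..1}" for n unfolding g_def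
    using absolutely_integrable_min_1[OF h absolutely_integrable_continuous_real[OF continuous_on_const]] .
  have "(\<lambda>n. integral {0..1} (g n)) \<longlonglongrightarrow> integral {0..1} h"
  proof (rule dominated_convergence(2))
    show "g n integrable_on {0..1}" for n using g by (rule set_lebesgue_integral_eq_integral(1))
    show "h integrable_on {0..1}" using h by (rule set_lebesgue_integral_eq_integral(1))
    show "norm (g n x) \<le> h x" for n x by (simp add: g_def h_def)
    show "(\<lambda>n. g n x) \<longlonglongrightarrow> h x" for x
    proof (rule tendsto_eventually)
      obtain m :: nat where "h x \<le> real m" using real_arch_simple by blast
      then have "\<forall>n\<ge>m. g n x = h x" by (auto simp: g_def)
      then show "\<forall>\<^sub>F n in sequentially. g n x = h x" by (auto simp: eventually_sequentially)
    qed
  qed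
  then have "\<forall>\<^sub>F n in sequentially. integral {0..1} (g n) > integral {0..1} h - \<epsilon> / 2"
    using e by (intro order_tendstoD(1)) auto
  then obtain n where n: "integral {0..1} (g n) > integral {0..1} h - \<epsilon> / 2"
    using eventually_happens'[OF sequentially_bot] by blast
  define k where "k x = h x - g n x" for x
  have k: "k absolutely_integrable_on {0..1}" unfolding k_def using h g by (rule set_integral_diff)
  have k0: "k x \<ge> 0" for x by (simp add: k_def g_def)
  have kint: "integral {0..1} k < \<epsilon> / 2"
    using n integral_diff[OF set_lebesgue_integral_eq_integral(1)[OF h] set_lebesgue_integral_eq_integral(1)[OF g]]
    unfolding k_def by simp
  \<comment> \<open>The summand 1 keeps the quotient meaningful when \<open>n\<close> is 0.\<close>
  define d where "d = \<epsilon> / (2 * (real n + 1))"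
  have "(\<Sum>(s, t)\<in>D. norm (integral {0..t} f - integral {0..s} f)) < \<epsilon>"
    if D: "finite D" "\<And>s t. (s, t) \<in> D \<Longrightarrow> 0 \<le> s \<and> s \<le> t \<and> t \<le> 1"
      "disjoint_family_on (\<lambda>(s, t). {s<..<t}) D" "(\<Sum>(s, t)\<in>D. t - s) < d" for D
  proof -
    have "(\<Sum>(s, t)\<in>D. norm (integral {0..t} f - integral {0..s} f))
        \<le> (\<Sum>(s, t)\<in>D. integral {s..t} k + real n * (t - s))"
    proof (rule sum_mono, clarify)
      fix s t assume "(s, t) \<in> D"
      then have st: "0 \<le> s" "s \<le> t" "t \<le> 1" using D(2) by auto
      have "integral {0..s} f + integral {s..t} f = integral {0..t} f"
        using st absolutely_integrable_on_sub01(2)[OF f, of 0 t] by (intro Henstock_Kurzweil_Integration.integral_combine) auto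
      then have "norm (integral {0..t} f - integral {0..s} f) = norm (integral {s..t} f)"
        by (simp flip: \<open>integral {0..s} f + integral {s..t} f = integral {0..t} f\<close>)
      also have "\<dots> \<le> integral {s..t} (\<lambda>x. k x + real n)"
      proof (rule integral_norm_bound_integral)
        show "f integrable_on {s..t}" by (rule absolutely_integrable_on_sub01(2)[OF f st(1,3)])
        show "(\<lambda>x. k x + real n) integrable_on {s..t}"
          by (rule integrable_add[OF absolutely_integrable_on_sub01(2)[OF k st(1,3)] integrable_const_ivl])
        show "norm (f x) \<le> k x + real n" for x by (simp add: k_def g_def h_def)
      qed
      also have "\<dots> = integral {s..t} k + real n * (t - s)"
        using st integral_add[OF absolutely_integrable_on_sub01(2)[OF k st(1,3)] integrable_const_ivl[of "real n" s t]]
        by simp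
      finally show "norm (integral {0..t} f - integral {0..s} f) \<le> integral {s..t} k + real n * (t - s)" .
    qed
    also have "\<dots> = (\<Sum>(s, t)\<in>D. integral {s..t} k) + real n * (\<Sum>(s, t)\<in>D. t - s)"
      unfolding case_prod_unfold sum.distrib sum_distrib_left ..
    also have "(\<Sum>(s, t)\<in>D. integral {s..t} k) \<le> integral {0..1} k"
    proof -
      \<comment> \<open>Only the open intervals are known to be disjoint; their end points do not
        affect the integrals.\<close>
      let ?A = "\<lambda>(s, t). {s<..<t} :: real set"
      have ki: "k absolutely_integrable_on {s<..<t}" if "(s, t) \<in> D" for s t
        using D(2)[OF that] by (intro set_integrable_subset[OF k]) auto
      have kU: "k absolutely_integrable_on (\<Union>p\<in>D. ?A p)"
      proof (rule set_integrable_subset[OF k])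
        show "(\<Union>p\<in>D. ?A p) \<in> sets lebesgue"
          using D(1) by (intro sets.finite_UN) (simp_all add: case_prod_unfold)
        show "(\<Union>p\<in>D. ?A p) \<subseteq> {0..1}"
        proof clarify
          fix x s t assume "(s, t) \<in> D" "x \<in> {s<..<t}"
          then show "x \<in> {0..1}" using D(2)[of s t] by auto
        qed
      qed
      have "(\<Sum>(s, t)\<in>D. integral {s..t} k) = (\<Sum>p\<in>D. LINT x:?A p|lebesgue. k x)"
      proof (rule sum.cong)
        fix p assume p: "p \<in> D"
        obtain s t where st: "p = (s, t)" by fastforce
        then have "(LINT x:{s<..<t}|lebesgue. k x) = integral {s<..<t} k"
          using ki p by (intro set_lebesgue_integral_eq_integral(2)) simp
        then show "(case p of (s, t) \<Rightarrow> integral {s..t} k) = (LINT x:?A p|lebesgue. k x)"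
          unfolding st prod.case by (simp add: integral_open_interval_real)
      qed simp
      also have "\<dots> = (LINT x:(\<Union>p\<in>D. ?A p)|lebesgue. k x)"
        by (rule set_integral_finite_Union[symmetric, OF D(1,3)]) (simp_all add: case_prod_unfold ki)
      also have "\<dots> = integral (\<Union>p\<in>D. ?A p) k"
        by (rule set_lebesgue_integral_eq_integral(2)[OF kU])
      also have "\<dots> \<le> integral {0..1} k"
      proof (rule integral_subset_le)
        show "(\<Union>p\<in>D. ?A p) \<subseteq> {0..1}"
        proof clarify
          fix x s t assume "(s, t) \<in> D" "x \<in> {s<..<t}"
          then show "x \<in> {0..1}" using D(2)[of s t] by auto
        qed
        show "k integrable_on (\<Union>p\<in>D. ?A p)"
          by (rule set_lebesgue_integral_eq_integral(1)[OF kU])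
      qed (use k0 set_lebesgue_integral_eq_integral(1)[OF k] in auto)
      finally show ?thesis .
    qed
    also have "real n * (\<Sum>(s, t)\<in>D. t - s) \<le> real n * d" using D(4) by (intro mult_left_mono) auto
    also have "real n * d \<le> \<epsilon> / 2"
      using e by (simp add: d_def field_simps)
    finally show ?thesis using kint by simp
  qed
  moreover have "d > 0" using e by (simp add: d_def)
  ultimately show "\<exists>\<delta>>0. \<forall>D. finite D \<longrightarrow> (\<forall>s t. (s, t) \<in> D \<longrightarrow> 0 \<le> s \<and> s \<le> t \<and> t \<le> 1) \<longrightarrow>
      disjoint_family_on (\<lambda>(s, t). {s<..<t}) D \<longrightarrow> (\<Sum>(s, t)\<in>D. t - s) < \<delta> \<longrightarrow>
      (\<Sum>(s, t)\<in>D. norm (integral {0..t} f - integral {0..s} f)) < \<epsilon>"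
    by blast
qed

section \<open>Linear Caratheodory equations\<close>

lemma absolutely_integrable_continuous_product:
  fixes f :: "real \<Rightarrow> 'a::euclidean_space" and g :: "real \<Rightarrow> 'b::euclidean_space"
    and h :: "'a \<Rightarrow> 'b \<Rightarrow> 'c::euclidean_space"
  assumes "bounded_bilinear h" "continuous_on {0..1} f" "g absolutely_integrable_on {0..1}"
  shows "(\<lambda>x. h (f x) (g x)) absolutely_integrable_on {0..1}"
proof (rule absolutely_integrable_bounded_measurable_product[where h = h and f = f and g = g])
  show "f \<in> borel_measurable (lebesgue_on {0..1})"
    using assms(2) by (intro continuous_imp_measurable_on_sets_lebesgue) auto
  show "bounded (f ` {0..1})"
    using assms(2) by (intro compact_imp_bounded compact_continuous_image) auto
qed (use assms in \<open>auto simp: bilinear_conv_bounded_bilinear\<close>)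

lemma continuous_on_integral:
  fixes f :: "real \<Rightarrow> 'a::euclidean_space"
  assumes "f absolutely_integrable_on {0..1}"
  shows "continuous_on {0..1} (\<lambda>x. integral {0..x} f)"
  using abs_cont_continuous[OF abs_cont_integral[OF assms]] .

section \<open>Exponential weights, Gronwall's inequality and Picard iteration\<close>

text \<open>The inequality 1 + t \<le> exp t at t = u - v. This Lipschitz bound lets the exponential
  of a primitive inherit absolute continuity.\<close>

lemma exp_diff_le:
  fixes u v B :: real
  assumes "\<bar>u\<bar> \<le> B" "\<bar>v\<bar> \<le> B"
  shows "\<bar>exp v - exp u\<bar> \<le> exp B * \<bar>v - u\<bar>"
proof -
  have *: "exp v - exp u \<le> exp B * (v - u)" if "u \<le> v" "v \<le> B" for u v :: real
  proof -
    have "exp v - exp u = exp v * (1 - exp (u - v))" by (simp add: algebra_simps flip: exp_add)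
    also have "\<dots> \<le> exp v * (v - u)"
      using exp_ge_add_one_self[of "u - v"] by (intro mult_left_mono) (linarith, simp)
    also have "\<dots> \<le> exp B * (v - u)" using that by (intro mult_right_mono) auto
    finally show ?thesis .
  qed
  show ?thesis
  proof (cases "u \<le> v")
    case True then show ?thesis using *[of u v] assms by auto
  next
    case False then show ?thesis using *[of v u] assms by auto
  qed
qed

text \<open>With \<open>M\<close> the primitive of \<open>m\<close>, exp (2 M) is absolutely
  continuous and has derivative 2 m exp (2 M) almost everywhere. The exponent 2 produces the factor
  1/2, which becomes the contraction constant of Picard iteration and the absorbable half in
  Gronwall's argument.\<close>

lemma has_integral_exp_weight:
  fixes m :: "real \<Rightarrow> real"
  assumes m: "m absolutely_integrable_on {0..1}" and x: "x \<in> {0..1}"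
  shows "((\<lambda>s. m s * exp (2 * integral {0..s} m)) has_integral
      (exp (2 * integral {0..x} m) - 1) / 2) {0..x}"
proof -
  define M where "M s = integral {0..s} m" for s
  define W where "W s = exp (2 * M s)" for s
  have M: "abs_cont M" unfolding M_def by (rule abs_cont_integral[OF m])
  obtain B where B: "\<And>s. s \<in> {0..1} \<Longrightarrow> \<bar>M s\<bar> \<le> B"
    using compact_imp_bounded[OF compact_continuous_image[OF abs_cont_continuous[OF M]]]
    unfolding bounded_iff real_norm_def by blast
  have W: "abs_cont W"
  proof (rule abs_cont_lipschitz[OF M M])
    show "exp (2 * B) > 0" by simp
    fix s t :: real assume st: "0 \<le> s" "s \<le> t" "t \<le> 1"
    then show "norm (W t - W s) \<le> exp (2 * B) * (norm (M t - M s) + norm (M t - M s))"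
      using exp_diff_le[of "2 * M s" "2 * B" "2 * M t"] B[of s] B[of t]
        abs_mult[of 2 "M t - M s"]
      by (simp add: W_def right_diff_distrib)
  qed
  define N where "N = {x \<in> {0..1}. \<not> (M has_vector_derivative m x) (at x within {0..1})}"
  have N: "negligible N" unfolding N_def M_def
    by (rule lebesgue_differentiation) (rule set_lebesgue_integral_eq_integral(1)[OF m])
  have "((\<lambda>s. W s * (2 * m s)) has_integral (W x - W 0)) {0..x}"
  proof (rule fundamental_theorem_of_calculus_abs_cont[OF W N])
    fix s assume "s \<in> {0..1} - N"
    then have "(M has_real_derivative m s) (at s within {0..1})"
      by (simp add: N_def has_real_derivative_iff_has_vector_derivative)
    then have "(W has_real_derivative W s * (2 * m s)) (at s within {0..1})"
      unfolding W_def by (auto intro!: derivative_eq_intros)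
    then show "(W has_vector_derivative W s * (2 * m s)) (at s within {0..1})"
      by (simp add: has_real_derivative_iff_has_vector_derivative)
  qed (use x in auto)
  then have "((\<lambda>s. (1/2) * (W s * (2 * m s))) has_integral (1/2) * (W x - W 0)) {0..x}"
    by (rule has_integral_mult_right)
  then show ?thesis by (simp add: W_def M_def mult.commute)
qed

text \<open>Let \<phi> exp (-2 M) attain its maximum S at z. Inserting \<phi> \<le> S exp (2 M) into
  the hypothesis at z gives \<phi> z \<le> A + (\<phi> z - S) / 2, hence S \<le> 2 A. The constant
  is not sharp, but any bound linear in \<open>A\<close> serves here.\<close>

lemma gronwall:
  fixes m \<phi> :: "real \<Rightarrow> real"
  assumes m: "m absolutely_integrable_on {0..1}" and m0: "\<And>s. s \<in> {0..1} \<Longrightarrow> m s \<ge> 0"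
    and \<phi>: "continuous_on {0..1} \<phi>" and \<phi>0: "\<And>s. s \<in> {0..1} \<Longrightarrow> \<phi> s \<ge> 0"
    and le: "\<And>x. x \<in> {0..1} \<Longrightarrow> \<phi> x \<le> A + integral {0..x} (\<lambda>s. m s * \<phi> s)"
    and x: "x \<in> {0..1}"
  shows "\<phi> x \<le> 2 * A * exp (2 * integral {0..1} m)"
proof -
  define M where "M s = integral {0..s} m" for s
  have Mc: "continuous_on {0..1} M" unfolding M_def by (rule continuous_on_integral[OF m])
  have M0: "0 \<le> M s" "M s \<le> M 1" if "s \<in> {0..1}" for s
  proof -
    show "0 \<le> M s" unfolding M_def using that m0
      by (intro integral_nonneg absolutely_integrable_on_sub01(2)[OF m]) auto
    show "M s \<le> M 1" unfolding M_def using that m0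
      by (intro integral_subset_le absolutely_integrable_on_sub01(2)[OF m]) auto
  qed
  have "continuous_on {0..1} (\<lambda>s. \<phi> s * exp (- 2 * M s))"
    by (intro continuous_intros Mc \<phi>)
  then obtain z where z: "z \<in> {0..1}" "\<And>s. s \<in> {0..1} \<Longrightarrow> \<phi> s * exp (- 2 * M s) \<le> \<phi> z * exp (- 2 * M z)"
    using continuous_attains_sup[of "{0..1}" "\<lambda>s. \<phi> s * exp (- 2 * M s)"] by fastforce
  define S where "S = \<phi> z * exp (- 2 * M z)"
  have S0: "S \<ge> 0" using \<phi>0 z by (simp add: S_def)
  have \<phi>S: "\<phi> s \<le> S * exp (2 * M s)" if "s \<in> {0..1}" for s
    using z(2)[OF that] by (simp add: S_def exp_minus field_simps)
  have mp: "(\<lambda>s. m s * \<phi> s) absolutely_integrable_on {0..1}"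
    using absolutely_integrable_continuous_product[OF bounded_bilinear_mult \<phi> m] by (simp add: mult.commute)
  have int: "((\<lambda>s. S * (m s * exp (2 * M s))) has_integral S * ((exp (2 * M z) - 1) / 2)) {0..z}"
    unfolding M_def by (intro has_integral_mult_right has_integral_exp_weight[OF m z(1)])
  have "\<phi> z \<le> A + integral {0..z} (\<lambda>s. m s * \<phi> s)" by (rule le[OF z(1)])
  also have "integral {0..z} (\<lambda>s. m s * \<phi> s) \<le> integral {0..z} (\<lambda>s. S * (m s * exp (2 * M s)))"
  proof (rule integral_le)
    show "(\<lambda>s. m s * \<phi> s) integrable_on {0..z}"
      using z(1) by (intro absolutely_integrable_on_sub01(2)[OF mp]) auto
    show "(\<lambda>s. S * (m s * exp (2 * M s))) integrable_on {0..z}" using int by blast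
    show "m s * \<phi> s \<le> S * (m s * exp (2 * M s))" if "s \<in> {0..z}" for s
    proof -
      have s: "s \<in> {0..1}" using that z(1) by auto
      show ?thesis using mult_left_mono[OF \<phi>S[OF s] m0[OF s]] by (simp add: mult_ac)
    qed
  qed
  also have "\<dots> = S * ((exp (2 * M z) - 1) / 2)" by (rule integral_unique[OF int])
  also have "\<dots> = (\<phi> z - S) / 2"
    by (simp add: S_def exp_minus field_simps)
  finally have "\<phi> z \<le> A + (\<phi> z - S) / 2" by simp
  then have *: "\<phi> z + S \<le> 2 * A" by argo
  have "\<phi> x \<le> S * exp (2 * M x)" by (rule \<phi>S[OF x])
  also have "\<dots> \<le> S * exp (2 * M 1)" using M0[OF x] S0 by (intro mult_left_mono) auto
  also have "\<dots> \<le> (2 * A) * exp (2 * M 1)" using * \<phi>0[OF z(1)] by (intro mult_right_mono) auto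
  finally show ?thesis by (simp add: M_def)
qed

text \<open>The Picard operator is a contraction for the supremum norm weighted by
  \<open>exp (-2 M)\<close>, where \<open>M\<close> is the primitive of \<open>m\<close>.\<close>

theorem caratheodory_exists:
  fixes F :: "real \<Rightarrow> 'e::euclidean_space \<Rightarrow> 'e"
  assumes F: "\<And>\<phi>. continuous_on {0..1} \<phi> \<Longrightarrow> (\<lambda>s. F s (\<phi> s)) absolutely_integrable_on {0..1}"
    and lip: "\<And>s v w. s \<in> {0..1} \<Longrightarrow> norm (F s v - F s w) \<le> m s * norm (v - w)"
    and m: "m absolutely_integrable_on {0..1}" and m0: "\<And>s. s \<in> {0..1} \<Longrightarrow> m s \<ge> 0"
  obtains Y where "continuous_on {0..1} Y"
    "\<And>x. x \<in> {0..1} \<Longrightarrow> Y x = c + integral {0..x} (\<lambda>s. F s (Y s))"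
proof -
  define M where "M s = integral {0..s} m" for s
  have Mc: "continuous_on {0..1} M" unfolding M_def by (rule continuous_on_integral[OF m])
  \<comment> \<open>The weight is moved into the unknown: \<open>\<psi>\<close> = exp (-2 M) times
    the solution, so that the weighted norm becomes the plain supremum norm of bounded continuous
    functions.\<close>
  define \<Phi> :: "(real, 'e) bcontfun \<Rightarrow> real \<Rightarrow> 'e" where "\<Phi> \<psi> s = exp (2 * M s) *\<^sub>R \<psi> s" for \<psi> s
  have \<Phi>c: "continuous_on {0..1} (\<Phi> \<psi>)" for \<psi> unfolding \<Phi>_def
    by (intro continuous_intros Mc continuous_on_apply_bcontfun)
  define G where "G \<psi> x = exp (- 2 * M x) *\<^sub>R (c + integral {0..x} (\<lambda>s. F s (\<Phi> \<psi> s)))" for \<psi> x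
  have "continuous_on (cbox 0 1) (G \<psi>)" for \<psi> unfolding G_def
    using continuous_on_integral[OF F[OF \<Phi>c]] Mc by (auto intro!: continuous_intros)
  \<comment> \<open>Members of the complete space live on the whole line; clamping extends a
    function from {0..1} without increasing its supremum.\<close>
  then have "\<exists>g::(real, 'e) bcontfun. \<forall>x. g x = G \<psi> (clamp 0 1 x)" for \<psi>
    by (rule continuous_on_cbox_bcontfunE) blast
  then obtain T :: "(real, 'e) bcontfun \<Rightarrow> (real, 'e) bcontfun" where T: "\<And>\<psi> x. T \<psi> x = G \<psi> (clamp 0 1 x)"
    by metis
  have contr: "dist (T \<psi>) (T \<xi>) \<le> 1/2 * dist \<psi> \<xi>" for \<psi> \<xi>
  proof (rule dist_bound)
    fix x0 :: real
    define x where "x = clamp 0 1 x0"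
    have x: "x \<in> {0..1}" using clamp_in_interval[of 0 1 x0] by (simp add: x_def)
    define d where "d = dist \<psi> \<xi>"
    have i: "(\<lambda>s. F s (\<Phi> u s)) integrable_on {0..x}" for u
      using x by (intro absolutely_integrable_on_sub01(2)[OF F[OF \<Phi>c]]) auto
    have int: "((\<lambda>s. d * (m s * exp (2 * M s))) has_integral d * ((exp (2 * M x) - 1) / 2)) {0..x}"
      unfolding M_def by (intro has_integral_mult_right has_integral_exp_weight[OF m x])
    have "dist (T \<psi> x0) (T \<xi> x0) = exp (- 2 * M x) * norm (integral {0..x} (\<lambda>s. F s (\<Phi> \<psi> s) - F s (\<Phi> \<xi> s)))"
      unfolding T x_def[symmetric] G_def dist_norm scaleR_diff_right[symmetric]
      using i by (simp add: integral_diff)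
    also have "norm (integral {0..x} (\<lambda>s. F s (\<Phi> \<psi> s) - F s (\<Phi> \<xi> s)))
        \<le> integral {0..x} (\<lambda>s. d * (m s * exp (2 * M s)))"
    proof (rule integral_norm_bound_integral)
      show "(\<lambda>s. F s (\<Phi> \<psi> s) - F s (\<Phi> \<xi> s)) integrable_on {0..x}" by (intro integrable_diff i)
      show "(\<lambda>s. d * (m s * exp (2 * M s))) integrable_on {0..x}" using int by blast
      fix s assume "s \<in> {0..x}"
      then have s: "s \<in> {0..1}" using x by auto
      have "norm (F s (\<Phi> \<psi> s) - F s (\<Phi> \<xi> s)) \<le> m s * norm (\<Phi> \<psi> s - \<Phi> \<xi> s)" by (rule lip[OF s])
      also have "norm (\<Phi> \<psi> s - \<Phi> \<xi> s) = exp (2 * M s) * dist (\<psi> s) (\<xi> s)"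
        unfolding \<Phi>_def scaleR_diff_right[symmetric] by (simp add: dist_norm)
      also have "m s * \<dots> \<le> m s * (exp (2 * M s) * d)" unfolding d_def
        using m0[OF s] by (intro mult_left_mono dist_bounded) auto
      finally show "norm (F s (\<Phi> \<psi> s) - F s (\<Phi> \<xi> s)) \<le> d * (m s * exp (2 * M s))"
        by (simp add: mult_ac)
    qed
    also have "\<dots> = d * ((exp (2 * M x) - 1) / 2)" by (rule integral_unique[OF int])
    also have "exp (- 2 * M x) * (d * ((exp (2 * M x) - 1) / 2)) = d / 2 - d * exp (- 2 * M x) / 2"
      by (simp add: exp_minus field_simps)
    also have "\<dots> \<le> 1/2 * d" by (simp add: d_def)
    finally show "dist (T \<psi> x0) (T \<xi> x0) \<le> 1/2 * dist \<psi> \<xi>" by (simp add: d_def)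
  qed
  then obtain \<psi> where \<psi>: "T \<psi> = \<psi>" using banach_fix_type[of "1/2" T] by auto
  show thesis
  proof (rule that[of "\<Phi> \<psi>"])
    show "continuous_on {0..1} (\<Phi> \<psi>)" by (rule \<Phi>c)
    fix x :: real assume x: "x \<in> {0..1}"
    then have "\<psi> x = G \<psi> x" using T[of \<psi> x] \<psi> by simp
    then show "\<Phi> \<psi> x = c + integral {0..x} (\<lambda>s. F s (\<Phi> \<psi> s))"
      by (simp add: \<Phi>_def[of _ x] G_def exp_minus)
  qed
qed

section \<open>The first order system\<close>

lemma sq_integrable_imp_absolutely_integrable:
  fixes f :: "real \<Rightarrow> 'a::euclidean_space"
  assumes "sq_integrable f"
  shows "f absolutely_integrable_on {0..1}" "(\<lambda>x. (norm (f x))\<^sup>2) absolutely_integrable_on {0..1}"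
proof -
  have i: "integrable leb01 (\<lambda>x. (norm (f x))\<^sup>2)" and f: "f \<in> borel_measurable leb01"
    using assms by (auto simp: sq_integrable_def)
  from i show sq: "(\<lambda>x. (norm (f x))\<^sup>2) absolutely_integrable_on {0..1}"
    by (simp add: set_integrable_def integrable_restrict_space)
  show "f absolutely_integrable_on {0..1}"
  proof (rule measurable_bounded_by_integrable_imp_absolutely_integrable[OF f])
    show "(\<lambda>x. 1 + (norm (f x))\<^sup>2) integrable_on {0..1}"
      by (intro integrable_add set_lebesgue_integral_eq_integral(1)[OF sq] integrable_const_ivl)
    show "norm (f x) \<le> 1 + (norm (f x))\<^sup>2" for x
    proof -
      have "2 * norm (f x) \<le> 1 + (norm (f x))\<^sup>2"
        using zero_le_power2[of "norm (f x) - 1"] by (simp add: power2_diff)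
      then show ?thesis using norm_ge_zero[of "f x"] by linarith
    qed
  qed auto
qed

text \<open>The product type carries only its real scalar multiplication; this is the complex one,
  needed for superposition with complex coefficients.\<close>

definition cscale :: "complex \<Rightarrow> complex \<times> complex \<Rightarrow> complex \<times> complex" where
  "cscale a v = (a * fst v, a * snd v)"

lemma fst_cscale [simp]: "fst (cscale a v) = a * fst v" and snd_cscale [simp]: "snd (cscale a v) = a * snd v"
  by (simp_all add: cscale_def)

lemma cscale_1 [simp]: "cscale 1 v = v" and cscale_minus_1 [simp]: "cscale (- 1) v = - v"
  by (simp_all add: cscale_def prod_eq_iff)

lemma norm_cscale: "norm (cscale a v) = cmod a * norm v"
  by (simp add: cscale_def norm_prod_def norm_mult power_mult_distrib real_sqrt_mult flip: distrib_left)

lemma bounded_linear_cscale: "bounded_linear (cscale a)"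
proof (rule bounded_linear_intro[where K = "cmod a"])
  show "norm (cscale a v) \<le> norm v * cmod a" for v by (simp add: norm_cscale)
qed (simp_all add: cscale_def algebra_simps)

locale singular_SL =
  fixes p r :: "real \<Rightarrow> real"
  assumes p: "sq_integrable p" and r: "sq_integrable r"
begin

lemma r_int: "r absolutely_integrable_on {0..1}"
  using sq_integrable_imp_absolutely_integrable[OF r] by simp

lemma r2_int: "(\<lambda>s. (r s)\<^sup>2) absolutely_integrable_on {0..1}"
  using sq_integrable_imp_absolutely_integrable[OF r] by simp

lemma p_int: "p absolutely_integrable_on {0..1}"
  using sq_integrable_imp_absolutely_integrable[OF p] by simp

text \<open>The equation \<open>T(\<mu>) y = g\<close> as a first order system for the pair of \<open>y\<close> and its
  quasi-derivative.\<close>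

definition field :: "complex \<Rightarrow> (real \<Rightarrow> complex) \<Rightarrow> real \<Rightarrow> complex \<times> complex \<Rightarrow> complex \<times> complex" where
  "field \<mu> g s v = (of_real (r s) * fst v + snd v,
     - of_real (r s) * snd v - (of_real ((r s)\<^sup>2) + \<mu>\<^sup>2 - 2 * \<mu> * of_real (p s)) * fst v + g s)"

text \<open>The sum of the moduli of the coefficients, with an upper bound \<Lambda> of |mu| in
  place of |mu|. One weight thus serves a whole disc of parameters, on which differentiability in mu
  relies.\<close>

definition weight :: "real \<Rightarrow> real \<Rightarrow> real" where
  "weight \<Lambda> s = 2 * \<bar>r s\<bar> + 1 + (r s)\<^sup>2 + \<Lambda>\<^sup>2 + 2 * \<Lambda> * \<bar>p s\<bar>"

text \<open>The integral form states absolute continuity and the differential equation almost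
  everywhere at once, and it is stable under changes of \<open>g\<close> on null sets. The initial
  value is left free.\<close>

definition solution :: "complex \<Rightarrow> (real \<Rightarrow> complex) \<Rightarrow> (real \<Rightarrow> complex \<times> complex) \<Rightarrow> bool" where
  "solution \<mu> g Y \<longleftrightarrow> continuous_on {0..1} Y \<and>
     (\<forall>x\<in>{0..1}. Y x = Y 0 + integral {0..x} (\<lambda>s. field \<mu> g s (Y s)))"

lemma solution_eq:
  assumes "solution \<mu> g Y" "x \<in> {0..1}"
  shows "Y 0 + integral {0..x} (\<lambda>s. field \<mu> g s (Y s)) = Y x"
  using assms unfolding solution_def by metis

lemma solution_continuous: "solution \<mu> g Y \<Longrightarrow> continuous_on {0..1} Y"
  unfolding solution_def by blast

lemma weight_nonneg: "\<Lambda> \<ge> 0 \<Longrightarrow> weight \<Lambda> s \<ge> 0"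
  by (simp add: weight_def)

lemma weight_int: "weight \<Lambda> absolutely_integrable_on {0..1}"
proof -
  have c: "(\<lambda>s. c) absolutely_integrable_on {0..1 :: real}" for c :: real
    by (rule absolutely_integrable_continuous_real[OF continuous_on_const])
  show ?thesis
    unfolding weight_def [abs_def]
    by (intro set_integral_add set_integrable_mult_right set_integrable_abs r_int r2_int p_int c)
qed

lemma norm_field_le:
  assumes "cmod \<mu> \<le> \<Lambda>"
  shows "norm (field \<mu> g s v) \<le> weight \<Lambda> s * norm v + cmod (g s)"
proof -
  define a b where "a = cmod (fst v)" and "b = cmod (snd v)"
  have ab: "a \<le> norm v" "b \<le> norm v" using norm_fst_le[of "fst v" "snd v"] norm_snd_le[of "snd v" "fst v"]
    by (simp_all add: a_def b_def)
  have L: "\<Lambda> \<ge> 0" using assms norm_ge_zero[of \<mu>] by linarith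
  have c: "cmod (of_real ((r s)\<^sup>2) + \<mu>\<^sup>2 - 2 * \<mu> * of_real (p s)) \<le> (r s)\<^sup>2 + \<Lambda>\<^sup>2 + 2 * \<Lambda> * \<bar>p s\<bar>"
  proof -
    have "cmod (of_real ((r s)\<^sup>2) + \<mu>\<^sup>2 - 2 * \<mu> * of_real (p s))
        \<le> cmod (of_real ((r s)\<^sup>2)) + cmod (\<mu>\<^sup>2) + cmod (2 * \<mu> * of_real (p s))"
      by (rule order_trans[OF norm_triangle_ineq4 add_right_mono[OF norm_triangle_ineq]])
    also have "\<dots> = (r s)\<^sup>2 + (cmod \<mu>)\<^sup>2 + 2 * cmod \<mu> * \<bar>p s\<bar>"
      by (simp add: norm_mult norm_power)
    also have "\<dots> \<le> (r s)\<^sup>2 + \<Lambda>\<^sup>2 + 2 * \<Lambda> * \<bar>p s\<bar>"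
    proof -
      have "(cmod \<mu>)\<^sup>2 \<le> \<Lambda>\<^sup>2" using assms by (intro power_mono) auto
      moreover have "cmod \<mu> * \<bar>p s\<bar> \<le> \<Lambda> * \<bar>p s\<bar>" using assms by (intro mult_right_mono) auto
      ultimately show ?thesis by (simp add: mult.assoc)
    qed
    finally show ?thesis .
  qed
  have "norm (field \<mu> g s v) \<le> cmod (of_real (r s) * fst v + snd v) +
      cmod (- of_real (r s) * snd v - (of_real ((r s)\<^sup>2) + \<mu>\<^sup>2 - 2 * \<mu> * of_real (p s)) * fst v + g s)"
    unfolding field_def by (rule norm_Pair_le)
  also have "\<dots> \<le> (\<bar>r s\<bar> * a + b) + ((\<bar>r s\<bar> * b + ((r s)\<^sup>2 + \<Lambda>\<^sup>2 + 2 * \<Lambda> * \<bar>p s\<bar>) * a) + cmod (g s))"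
  proof (intro add_mono)
    show "cmod (of_real (r s) * fst v + snd v) \<le> \<bar>r s\<bar> * a + b"
      unfolding a_def b_def by (rule order_trans[OF norm_triangle_ineq]) (simp add: norm_mult)
    have "cmod (- of_real (r s) * snd v - (of_real ((r s)\<^sup>2) + \<mu>\<^sup>2 - 2 * \<mu> * of_real (p s)) * fst v + g s)
        \<le> cmod (- of_real (r s) * snd v) + cmod ((of_real ((r s)\<^sup>2) + \<mu>\<^sup>2 - 2 * \<mu> * of_real (p s)) * fst v) + cmod (g s)"
      by (rule order_trans[OF norm_triangle_ineq add_right_mono[OF norm_triangle_ineq4]])
    also have "\<dots> \<le> (\<bar>r s\<bar> * b + ((r s)\<^sup>2 + \<Lambda>\<^sup>2 + 2 * \<Lambda> * \<bar>p s\<bar>) * a) + cmod (g s)"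
      using mult_right_mono[OF c, of a] by (simp add: norm_mult a_def b_def)
    finally show "cmod (- of_real (r s) * snd v - (of_real ((r s)\<^sup>2) + \<mu>\<^sup>2 - 2 * \<mu> * of_real (p s)) * fst v + g s)
      \<le> (\<bar>r s\<bar> * b + ((r s)\<^sup>2 + \<Lambda>\<^sup>2 + 2 * \<Lambda> * \<bar>p s\<bar>) * a) + cmod (g s)" .
  qed
  also have "\<dots> \<le> (\<bar>r s\<bar> * norm v + norm v) + ((\<bar>r s\<bar> * norm v + ((r s)\<^sup>2 + \<Lambda>\<^sup>2 + 2 * \<Lambda> * \<bar>p s\<bar>) * norm v) + cmod (g s))"
    using ab L by (intro add_mono mult_left_mono) auto
  also have "\<dots> = weight \<Lambda> s * norm v + cmod (g s)" by (simp add: weight_def algebra_simps)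
  finally show ?thesis .
qed

lemma field_combine:
  "field \<mu> (\<lambda>s. a * g s + b * h s) s (cscale a v + cscale b w)
    = cscale a (field \<mu> g s v) + cscale b (field \<mu> h s w)"
  by (simp add: field_def prod_eq_iff algebra_simps)

lemma field_integrable:
  assumes g: "g absolutely_integrable_on {0..1}" and Y: "continuous_on {0..1} Y"
  shows "(\<lambda>s. field \<mu> g s (Y s)) absolutely_integrable_on {0..1}"
proof -
  note prod = absolutely_integrable_continuous_product[OF bounded_bilinear.flip[OF bounded_bilinear_scaleR]]
  have "(\<lambda>s. r s *\<^sub>R (fst (Y s), - snd (Y s)) + (r s)\<^sup>2 *\<^sub>R (0, - fst (Y s))
      + p s *\<^sub>R (0, 2 * \<mu> * fst (Y s)) + (snd (Y s), - \<mu>\<^sup>2 * fst (Y s)) + (0, g s)) absolutely_integrable_on {0..1}"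
  proof (intro set_integral_add)
    show "(\<lambda>s. (0 :: complex, g s)) absolutely_integrable_on {0..1}"
      using absolutely_integrable_linear[OF g, of "\<lambda>x. (0 :: complex, x)"]
      by (simp add: o_def bounded_linear_Pair bounded_linear_zero bounded_linear_ident)
    show "(\<lambda>s. (snd (Y s), - \<mu>\<^sup>2 * fst (Y s))) absolutely_integrable_on {0..1}"
      by (intro absolutely_integrable_continuous_real continuous_intros Y)
    show "(\<lambda>s. r s *\<^sub>R (fst (Y s), - snd (Y s))) absolutely_integrable_on {0..1}"
      by (rule prod) (intro r_int continuous_intros Y)+
    show "(\<lambda>s. (r s)\<^sup>2 *\<^sub>R (0 :: complex, - fst (Y s))) absolutely_integrable_on {0..1}"
      by (rule prod) (intro r2_int continuous_intros Y)+
    show "(\<lambda>s. p s *\<^sub>R (0 :: complex, 2 * \<mu> * fst (Y s))) absolutely_integrable_on {0..1}"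
      by (rule prod) (intro p_int continuous_intros Y)+
  qed
  also have "(\<lambda>s. r s *\<^sub>R (fst (Y s), - snd (Y s)) + (r s)\<^sup>2 *\<^sub>R (0, - fst (Y s))
      + p s *\<^sub>R (0, 2 * \<mu> * fst (Y s)) + (snd (Y s), - \<mu>\<^sup>2 * fst (Y s)) + (0, g s))
    = (\<lambda>s. field \<mu> g s (Y s))"
    by (rule ext) (simp add: field_def scaleR_conv_of_real algebra_simps)
  finally show ?thesis .
qed

lemma solution_exists:
  assumes g: "g absolutely_integrable_on {0..1}"
  obtains Y where "solution \<mu> g Y" "Y 0 = c"
proof -
  have "norm (field \<mu> g s v - field \<mu> g s w) \<le> weight (cmod \<mu>) s * norm (v - w)" for s v w
  proof -
    \<comment> \<open>The forcing cancels in the difference, so the growth bound of the homogeneous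
      field is already a Lipschitz bound.\<close>
    have "field \<mu> g s v - field \<mu> g s w = field \<mu> (\<lambda>s. 0) s (v - w)"
      by (simp add: field_def algebra_simps)
    then show ?thesis using norm_field_le[of \<mu> "cmod \<mu>" "\<lambda>s. 0" s "v - w"] by simp
  qed
  note lip = this
  show thesis
  proof (rule caratheodory_exists[where c = c, OF field_integrable[OF g] lip weight_int weight_nonneg[OF norm_ge_zero]])
    fix Y assume Y: "continuous_on {0..1} Y"
      "\<And>x. x \<in> {0..1} \<Longrightarrow> Y x = c + integral {0..x} (\<lambda>s. field \<mu> g s (Y s))"
    then have "Y 0 = c" using Y(2)[of 0] by simp
    then show thesis using that[of Y] Y by (simp add: solution_def)
  qed
qed

text \<open>Gronwall with the constant |Y 0| + integral of |g|. This one estimate yields uniqueness,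
  the bound on the inverse of the pencil and, through its uniformity in |mu| \<le> \<Lambda>, the
  differentiability in mu.\<close>

lemma solution_bound:
  assumes g: "g absolutely_integrable_on {0..1}" and Y: "solution \<mu> g Y"
    and L: "cmod \<mu> \<le> \<Lambda>" and x: "x \<in> {0..1}"
  shows "norm (Y x) \<le> 2 * exp (2 * integral {0..1} (weight \<Lambda>)) * (norm (Y 0) + integral {0..1} (\<lambda>s. cmod (g s)))"
proof -
  have Yc: "continuous_on {0..1} Y" using Y by (rule solution_continuous)
  have L0: "\<Lambda> \<ge> 0" using L norm_ge_zero[of \<mu>] by linarith
  have gn: "(\<lambda>s. cmod (g s)) absolutely_integrable_on {0..1}"
    using absolutely_integrable_norm[OF g] by (simp add: o_def)
  have wY: "(\<lambda>s. weight \<Lambda> s * norm (Y s)) absolutely_integrable_on {0..1}"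
    using absolutely_integrable_continuous_product[OF bounded_bilinear_mult continuous_on_norm[OF Yc] weight_int]
    by (simp add: mult.commute)
  have "norm (Y x) \<le> 2 * (norm (Y 0) + integral {0..1} (\<lambda>s. cmod (g s))) * exp (2 * integral {0..1} (weight \<Lambda>))"
  proof (rule gronwall[OF weight_int weight_nonneg[OF L0] continuous_on_norm[OF Yc] norm_ge_zero _ x])
    fix x :: real assume x: "x \<in> {0..1}"
    then have x': "(0::real) \<le> 0" "x \<le> 1" by auto
    have "norm (Y x) = norm (Y 0 + integral {0..x} (\<lambda>s. field \<mu> g s (Y s)))"
      by (simp only: solution_eq[OF Y x])
    also have "\<dots> \<le> norm (Y 0) + norm (integral {0..x} (\<lambda>s. field \<mu> g s (Y s)))" by (rule norm_triangle_ineq)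
    also have "norm (integral {0..x} (\<lambda>s. field \<mu> g s (Y s)))
        \<le> integral {0..x} (\<lambda>s. weight \<Lambda> s * norm (Y s) + cmod (g s))"
    proof (rule integral_norm_bound_integral)
      show "(\<lambda>s. field \<mu> g s (Y s)) integrable_on {0..x}"
        by (rule absolutely_integrable_on_sub01(2)[OF field_integrable[OF g Yc] x'])
      show "(\<lambda>s. weight \<Lambda> s * norm (Y s) + cmod (g s)) integrable_on {0..x}"
        by (rule integrable_add[OF absolutely_integrable_on_sub01(2)[OF wY x'] absolutely_integrable_on_sub01(2)[OF gn x']])
    qed (rule norm_field_le[OF L])
    also have "\<dots> = integral {0..x} (\<lambda>s. weight \<Lambda> s * norm (Y s)) + integral {0..x} (\<lambda>s. cmod (g s))"
      by (rule integral_add[OF absolutely_integrable_on_sub01(2)[OF wY x'] absolutely_integrable_on_sub01(2)[OF gn x']])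
    also have "integral {0..x} (\<lambda>s. cmod (g s)) \<le> integral {0..1} (\<lambda>s. cmod (g s))"
      using x by (intro integral_subset_le absolutely_integrable_on_sub01(2)[OF gn]) auto
    finally show "norm (Y x) \<le> norm (Y 0) + integral {0..1} (\<lambda>s. cmod (g s))
        + integral {0..x} (\<lambda>s. weight \<Lambda> s * norm (Y s))" by simp
  qed
  then show ?thesis by (simp only: mult_ac)
qed

lemma solution_combine:
  assumes g: "g absolutely_integrable_on {0..1}" and Y: "solution \<mu> g Y"
    and h: "h absolutely_integrable_on {0..1}" and Z: "solution \<mu> h Z"
  shows "solution \<mu> (\<lambda>s. a * g s + b * h s) (\<lambda>s. cscale a (Y s) + cscale b (Z s))"
  unfolding solution_def
proof (intro conjI ballI)
  have c: "continuous_on {0..1} Y" "continuous_on {0..1} Z" using Y Z by (auto intro: solution_continuous)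
  then show "continuous_on {0..1} (\<lambda>s. cscale a (Y s) + cscale b (Z s))"
    unfolding cscale_def by (intro continuous_intros)
  fix x :: real assume x: "x \<in> {0..1}"
  have i: "(\<lambda>s. field \<mu> g s (Y s)) integrable_on {0..x}" "(\<lambda>s. field \<mu> h s (Z s)) integrable_on {0..x}"
    using x absolutely_integrable_on_sub01(2)[OF field_integrable[OF g c(1)]]
      absolutely_integrable_on_sub01(2)[OF field_integrable[OF h c(2)]] by auto
  let ?I = "integral {0..x} (\<lambda>s. field \<mu> g s (Y s))" and ?J = "integral {0..x} (\<lambda>s. field \<mu> h s (Z s))"
  have "((\<lambda>s. cscale a (field \<mu> g s (Y s)) + cscale b (field \<mu> h s (Z s)))
      has_integral (cscale a ?I + cscale b ?J)) {0..x}"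
    using has_integral_add[OF has_integral_linear[OF integrable_integral[OF i(1)] bounded_linear_cscale]
        has_integral_linear[OF integrable_integral[OF i(2)] bounded_linear_cscale]]
    by (simp only: o_def)
  then have "integral {0..x} (\<lambda>s. field \<mu> (\<lambda>s. a * g s + b * h s) s (cscale a (Y s) + cscale b (Z s)))
      = cscale a ?I + cscale b ?J"
    by (simp only: field_combine integral_unique)
  moreover have "cscale a (Y x) + cscale b (Z x) = cscale a (Y 0) + cscale b (Z 0) + (cscale a ?I + cscale b ?J)"
    unfolding solution_eq[OF Y x, symmetric] solution_eq[OF Z x, symmetric]
    by (simp only: cscale_def fst_add snd_add distrib_left add_Pair add_ac)
  ultimately show "cscale a (Y x) + cscale b (Z x) = cscale a (Y 0) + cscale b (Z 0) +
      integral {0..x} (\<lambda>s. field \<mu> (\<lambda>s. a * g s + b * h s) s (cscale a (Y s) + cscale b (Z s)))"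
    by (simp only:)
qed

lemma zero_int: "(\<lambda>s. 0 :: complex) absolutely_integrable_on {0..1 :: real}"
  by simp

lemma solution_unique:
  assumes g: "g absolutely_integrable_on {0..1}" and Y: "solution \<mu> g Y" and Z: "solution \<mu> g Z"
    and 0: "Y 0 = Z 0" and x: "x \<in> {0..1}"
  shows "Y x = Z x"
proof -
  have "solution \<mu> (\<lambda>s. 1 * g s + (-1) * g s) (\<lambda>s. cscale 1 (Y s) + cscale (-1) (Z s))"
    by (rule solution_combine[OF g Y g Z])
  then have "solution \<mu> (\<lambda>s. 0) (\<lambda>s. cscale 1 (Y s) + cscale (-1) (Z s))" by simp
  from solution_bound[OF zero_int this order_refl x]
  show ?thesis using 0 by simp
qed

text \<open>The coefficients for \<mu> and \<nu> differ by (\<mu> - \<nu>) (\<mu> + \<nu> - 2 p),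
  and the difference times y is moved to the forcing. With two nearby parameters this is the
  perturbation formula; with one parameter equal to 0 it relates the pencil to A, as T(0) =
  -A.\<close>

lemma solution_change_parameter:
  assumes "solution \<mu> g Y"
  shows "solution \<nu> (\<lambda>s. g s + (\<mu> - \<nu>) * (2 * of_real (p s) - (\<mu> + \<nu>)) * fst (Y s)) Y"
proof -
  have eq: "field \<nu> (\<lambda>s. g s + (\<mu> - \<nu>) * (2 * of_real (p s) - (\<mu> + \<nu>)) * fst (Y s)) s (Y s) = field \<mu> g s (Y s)" for s
    by (simp add: field_def algebra_simps power2_eq_square)
  show ?thesis using assms unfolding solution_def eq .
qed

end

section \<open>The fundamental solution and its dependence on the spectral parameter\<close>

context singular_SL
begin

text \<open>A choice is made because \<open>solution\<close> constrains functions on {0..1} only, so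
  uniqueness holds only there.\<close>

definition fund :: "complex \<Rightarrow> real \<Rightarrow> complex \<times> complex" where
  "fund \<mu> = (SOME Y. solution \<mu> (\<lambda>s. 0) Y \<and> Y 0 = (0, 1))"

definition characteristic :: "complex \<Rightarrow> complex" where
  "characteristic \<mu> = fst (fund \<mu> 1)"

lemma fund: "solution \<mu> (\<lambda>s. 0) (fund \<mu>)" "fund \<mu> 0 = (0, 1)"
proof -
  have "\<exists>Y. solution \<mu> (\<lambda>s. 0) Y \<and> Y 0 = (0, 1)"
    using solution_exists[OF zero_int, of \<mu> "(0, 1)"] by metis
  from someI_ex[OF this] show "solution \<mu> (\<lambda>s. 0) (fund \<mu>)" "fund \<mu> 0 = (0, 1)"
    unfolding fund_def by blast+
qed

lemma product_p_int:
  assumes "continuous_on {0..1} (y :: real \<Rightarrow> complex)"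
  shows "(\<lambda>s. a * (2 * of_real (p s) - b) * y s) absolutely_integrable_on {0..1}"
proof -
  have pc: "(\<lambda>s. complex_of_real (p s)) absolutely_integrable_on {0..1}"
    using absolutely_integrable_linear[OF p_int bounded_linear_of_real] by (simp add: o_def)
  have "(\<lambda>s. (2 * a * y s) * complex_of_real (p s) + (- (a * b * y s))) absolutely_integrable_on {0..1}"
    by (rule set_integral_add(1)[OF absolutely_integrable_continuous_product[OF bounded_bilinear_mult _ pc]
          absolutely_integrable_continuous_real]) (intro continuous_intros assms)+
  then show ?thesis by (simp add: algebra_simps)
qed

text \<open>Rewritten at the parameter \<open>\<mu>\<^sub>0\<close>, the difference \<open>D\<close>
  of two fundamental solutions has zero initial value and forcing of order h =
  \<open>\<mu> - \<mu>\<^sub>0\<close>. Subtracting h times the solution \<open>W\<close> of the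
  linearised equation leaves \<open>E\<close> with forcing of order h^2. Two uses of
  \<open>solution_bound\<close> turn these orders into bounds, and the derivative is the first
  component of \<open>W 1\<close>.\<close>

lemma characteristic_differentiable: "\<exists>D. (characteristic has_field_derivative D) (at \<mu>\<^sub>0)"
proof -
  \<comment> \<open>Covers all parameters within distance 1 of \<open>\<mu>\<^sub>0\<close>, so that
    \<open>K\<close> bounds all the fundamental solutions involved.\<close>
  define \<Lambda> where "\<Lambda> = cmod \<mu>\<^sub>0 + 1"
  define K where "K = 2 * exp (2 * integral {0..1} (weight \<Lambda>))"
  define P where "P s = 2 * \<bar>p s\<bar> + 2 * \<Lambda>" for s
  have K0: "K \<ge> 0" by (simp add: K_def)
  have L0: "\<Lambda> \<ge> 0" "cmod \<mu>\<^sub>0 \<le> \<Lambda>" by (auto simp: \<Lambda>_def)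
  have P0: "P s \<ge> 0" for s using L0 by (simp add: P_def)
  have Pint: "P absolutely_integrable_on {0..1}" unfolding P_def [abs_def]
    by (intro set_integral_add set_integrable_mult_right set_integrable_abs p_int
        absolutely_integrable_continuous_real[OF continuous_on_const])
  then have Pi: "P integrable_on {0..1}" by (rule set_lebesgue_integral_eq_integral(1))
  have yc: "continuous_on {0..1} (\<lambda>s. fst (fund \<mu> s))" for \<mu>
    by (intro continuous_on_fst solution_continuous[OF fund(1)])
  have fb: "norm (fund \<mu> x) \<le> K" if "cmod \<mu> \<le> \<Lambda>" "x \<in> {0..1}" for \<mu> x
    using solution_bound[OF zero_int fund(1) that] by (simp add: fund(2) K_def)
  define gW where "gW s = 1 * (2 * of_real (p s) - 2 * \<mu>\<^sub>0) * fst (fund \<mu>\<^sub>0 s)" for s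
  have gW: "gW absolutely_integrable_on {0..1}"
    unfolding gW_def [abs_def] by (rule product_p_int[OF yc])
  \<comment> \<open>\<open>W\<close> solves the equation obtained by formal differentiation in the
    parameter at \<open>\<mu>\<^sub>0\<close>; the initial value is 0 because that of
    \<open>fund\<close> is independent of the parameter.\<close>
  obtain W where W: "solution \<mu>\<^sub>0 gW W" "W 0 = 0" using solution_exists[OF gW] by metis
  define I where "I = integral {0..1} P"
  have I0: "I \<ge> 0" unfolding I_def by (intro integral_nonneg Pi P0)
  \<comment> \<open>Here K * (K * I) is the bound for D / h. Integrated against \<open>P\<close> and
    increased by the contribution K of the h^2 term, it passes once more through
    \<open>solution_bound\<close>, which supplies the outer factor K.\<close>
  define C where "C = K * (K * (K * I) * I + K)"
  have C0: "C \<ge> 0" using K0 I0 by (simp add: C_def)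
  have est: "cmod (characteristic \<mu> - characteristic \<mu>\<^sub>0 - fst (W 1) * (\<mu> - \<mu>\<^sub>0)) \<le> C * (cmod (\<mu> - \<mu>\<^sub>0))\<^sup>2"
    if "cmod (\<mu> - \<mu>\<^sub>0) \<le> 1" for \<mu>
  proof -
    define h where "h = \<mu> - \<mu>\<^sub>0"
    have m: "cmod \<mu> \<le> \<Lambda>"
      using that norm_triangle_ineq[of "\<mu> - \<mu>\<^sub>0" "\<mu>\<^sub>0"] by (simp add: \<Lambda>_def)
    define g where "g s = 0 + (\<mu> - \<mu>\<^sub>0) * (2 * of_real (p s) - (\<mu> + \<mu>\<^sub>0)) * fst (fund \<mu> s)" for s
    have g: "g absolutely_integrable_on {0..1}"
      unfolding g_def [abs_def] add_0 by (rule product_p_int[OF yc])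
    have Ys: "solution \<mu>\<^sub>0 g (fund \<mu>)"
      unfolding g_def [abs_def] by (rule solution_change_parameter[OF fund(1)])
    define D where "D s = cscale 1 (fund \<mu> s) + cscale (-1) (fund \<mu>\<^sub>0 s)" for s
    have gD: "(\<lambda>s. 1 * g s + (-1) * 0) absolutely_integrable_on {0..1}" using g by simp
    have D: "solution \<mu>\<^sub>0 (\<lambda>s. 1 * g s + (-1) * 0) D"
      unfolding D_def [abs_def] by (rule solution_combine[OF g Ys zero_int fund(1)])
    have D0: "D 0 = 0" by (simp add: D_def fund(2) zero_prod_def)
    have coef: "cmod (2 * of_real (p s) - (\<mu> + \<mu>\<^sub>0)) \<le> P s" "cmod (2 * of_real (p s) - 2 * \<mu>\<^sub>0) \<le> P s" for s
    proof -
      have "cmod (2 * of_real (p s) - (\<mu> + \<mu>\<^sub>0)) \<le> cmod (2 * of_real (p s)) + (cmod \<mu> + cmod \<mu>\<^sub>0)"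
        by (rule order_trans[OF norm_triangle_ineq4 add_left_mono[OF norm_triangle_ineq]])
      then show "cmod (2 * of_real (p s) - (\<mu> + \<mu>\<^sub>0)) \<le> P s"
        using m L0 by (simp add: P_def norm_mult)
      have "cmod (2 * of_real (p s) - 2 * \<mu>\<^sub>0) \<le> cmod (2 * of_real (p s)) + cmod (2 * \<mu>\<^sub>0)"
        by (rule norm_triangle_ineq4)
      then show "cmod (2 * of_real (p s) - 2 * \<mu>\<^sub>0) \<le> P s"
        using L0 by (simp add: P_def norm_mult)
    qed
    have Db: "norm (D x) \<le> cmod h * (K * (K * I))" if x: "x \<in> {0..1}" for x
    proof -
      have "norm (D x) \<le> K * (norm (D 0) + integral {0..1} (\<lambda>s. cmod (1 * g s + (-1) * 0)))"
        using solution_bound[OF gD D L0(2) x] by (simp only: K_def)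
      also have "\<dots> = K * integral {0..1} (\<lambda>s. cmod (g s))" by (simp add: D0)
      also have "\<dots> \<le> K * integral {0..1} (\<lambda>s. cmod h * K * P s)"
      proof (intro mult_left_mono integral_le K0)
        show "(\<lambda>s. cmod (g s)) integrable_on {0..1}"
          using absolutely_integrable_norm[OF g] by (simp add: o_def set_lebesgue_integral_eq_integral(1))
        show "(\<lambda>s. cmod h * K * P s) integrable_on {0..1}" by (intro integrable_on_mult_right Pi)
        fix s :: real assume s: "s \<in> {0..1}"
        have "cmod (fst (fund \<mu> s)) \<le> K"
          using fb[OF m s] norm_fst_le[of "fst (fund \<mu> s)" "snd (fund \<mu> s)"] by simp
        then have "cmod (2 * of_real (p s) - (\<mu> + \<mu>\<^sub>0)) * cmod (fst (fund \<mu> s)) \<le> P s * K"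
          by (intro mult_mono coef P0) auto
        from mult_left_mono[OF this norm_ge_zero[of h]]
        show "cmod (g s) \<le> cmod h * K * P s" by (simp add: g_def h_def norm_mult mult_ac)
      qed
      also have "\<dots> = cmod h * (K * (K * I))" by (simp add: I_def)
      finally show ?thesis .
    qed
    define gE where "gE s = 1 * (1 * g s + (-1) * 0) + (- h) * gW s" for s
    define E where "E s = cscale 1 (D s) + cscale (- h) (W s)" for s
    have E: "solution \<mu>\<^sub>0 gE E"
      unfolding E_def [abs_def] gE_def [abs_def] by (rule solution_combine[OF gD D gW W(1)])
    have gE: "gE absolutely_integrable_on {0..1}"
      unfolding gE_def [abs_def] by (intro set_integral_add set_integrable_mult_right gD gW)
    have E0: "E 0 = 0" by (simp add: E_def D0 W(2) cscale_def zero_prod_def)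
    have one: "(1::real) \<in> {0..1}" by simp
    have "norm (E 1) \<le> K * (norm (E 0) + integral {0..1} (\<lambda>s. cmod (gE s)))"
      using solution_bound[OF gE E L0(2) one] by (simp only: K_def)
    also have "\<dots> = K * integral {0..1} (\<lambda>s. cmod (gE s))" by (simp add: E0)
    also have "\<dots> \<le> K * integral {0..1} (\<lambda>s. (cmod h)\<^sup>2 * (K * (K * I)) * P s + (cmod h)\<^sup>2 * K)"
    proof (intro mult_left_mono integral_le K0)
      show "(\<lambda>s. cmod (gE s)) integrable_on {0..1}"
        using absolutely_integrable_norm[OF gE] by (simp add: o_def set_lebesgue_integral_eq_integral(1))
      show "(\<lambda>s. (cmod h)\<^sup>2 * (K * (K * I)) * P s + (cmod h)\<^sup>2 * K) integrable_on {0..1}"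
        by (rule integrable_add[OF integrable_on_mult_right[OF Pi] integrable_const_ivl])
      fix s :: real assume s: "s \<in> {0..1}"
      have f1: "cmod (fst (fund \<mu> s)) \<le> K"
        using fb[OF m s] norm_fst_le[of "fst (fund \<mu> s)" "snd (fund \<mu> s)"] by simp
      have f2: "cmod (fst (D s)) \<le> cmod h * (K * (K * I))"
        using Db[OF s] norm_fst_le[of "fst (D s)" "snd (D s)"] by simp
      \<comment> \<open>The two coefficients 2 p - (\<mu> + \<open>\<mu>\<^sub>0\<close>) and 2 p -
        2 \<open>\<mu>\<^sub>0\<close> differ by h. Splitting this off leaves one term with
        \<open>D\<close> and one with a second factor h, both small.\<close>
      have "gE s = h * ((2 * of_real (p s) - 2 * \<mu>\<^sub>0) * fst (D s) - h * fst (fund \<mu> s))"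
        by (simp add: gE_def g_def gW_def D_def h_def algebra_simps)
      also have "cmod \<dots> = cmod h * cmod ((2 * of_real (p s) - 2 * \<mu>\<^sub>0) * fst (D s) - h * fst (fund \<mu> s))"
        by (rule norm_mult)
      also have "\<dots> \<le> cmod h * (P s * (cmod h * (K * (K * I))) + cmod h * K)"
      proof (rule mult_left_mono[OF order_trans[OF norm_triangle_ineq4]])
        show "cmod ((2 * of_real (p s) - 2 * \<mu>\<^sub>0) * fst (D s)) + cmod (h * fst (fund \<mu> s))
            \<le> P s * (cmod h * (K * (K * I))) + cmod h * K"
          unfolding norm_mult[of _ "fst (D s)"] norm_mult[of h]
          by (intro add_mono mult_mono mult_left_mono coef f1 f2 P0 norm_ge_zero)
      qed simp
      also have "\<dots> = (cmod h)\<^sup>2 * (K * (K * I)) * P s + (cmod h)\<^sup>2 * K"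
        by (simp add: algebra_simps power2_eq_square)
      finally show "cmod (gE s) \<le> (cmod h)\<^sup>2 * (K * (K * I)) * P s + (cmod h)\<^sup>2 * K" .
    qed
    also have "integral {0..1} (\<lambda>s. (cmod h)\<^sup>2 * (K * (K * I)) * P s + (cmod h)\<^sup>2 * K)
        = (cmod h)\<^sup>2 * (K * (K * I)) * I + (cmod h)\<^sup>2 * K"
      using integral_add[OF integrable_on_mult_right[OF Pi] integrable_const_ivl,
          of "(cmod h)\<^sup>2 * (K * (K * I))" "(cmod h)\<^sup>2 * K"] by (simp add: I_def)
    also have "K * ((cmod h)\<^sup>2 * (K * (K * I)) * I + (cmod h)\<^sup>2 * K) = C * (cmod h)\<^sup>2"
      by (simp add: C_def algebra_simps)
    finally have "cmod (fst (E 1)) \<le> C * (cmod h)\<^sup>2"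
      using norm_fst_le[of "fst (E 1)" "snd (E 1)"] by simp
    moreover have "fst (E 1) = characteristic \<mu> - characteristic \<mu>\<^sub>0 - fst (W 1) * (\<mu> - \<mu>\<^sub>0)"
      by (simp add: E_def D_def characteristic_def h_def algebra_simps)
    ultimately show ?thesis by (simp add: h_def)
  qed
  have "(characteristic has_field_derivative fst (W 1)) (at \<mu>\<^sub>0)"
    unfolding has_field_derivative_def has_derivative_at_alt
  proof (intro conjI allI impI bounded_linear_mult_right)
    fix e :: real assume e: "e > 0"
    show "\<exists>d>0. \<forall>\<mu>. norm (\<mu> - \<mu>\<^sub>0) < d \<longrightarrow>
        norm (characteristic \<mu> - characteristic \<mu>\<^sub>0 - fst (W 1) * (\<mu> - \<mu>\<^sub>0)) \<le> e * norm (\<mu> - \<mu>\<^sub>0)"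
    proof (intro exI[of _ "min 1 (e / (C + 1))"] conjI allI impI)
      show "min 1 (e / (C + 1)) > 0" using e C0 by simp
      fix \<mu> assume *: "norm (\<mu> - \<mu>\<^sub>0) < min 1 (e / (C + 1))"
      then have "C * cmod (\<mu> - \<mu>\<^sub>0) \<le> (C + 1) * (e / (C + 1))"
        using C0 by (intro mult_mono) auto
      then have "C * cmod (\<mu> - \<mu>\<^sub>0) * cmod (\<mu> - \<mu>\<^sub>0) \<le> e * cmod (\<mu> - \<mu>\<^sub>0)"
        using C0 by (intro mult_right_mono) auto
      then show "norm (characteristic \<mu> - characteristic \<mu>\<^sub>0 - fst (W 1) * (\<mu> - \<mu>\<^sub>0)) \<le> e * norm (\<mu> - \<mu>\<^sub>0)"
        using est[of \<mu>] * by (simp add: power2_eq_square mult.assoc)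
    qed
  qed
  then show ?thesis by blast
qed

end

section \<open>The characteristic function does not vanish identically\<close>

lemma abs_cont_integral_eq:
  fixes F :: "real \<Rightarrow> 'a::euclidean_space"
  assumes f: "f absolutely_integrable_on {0..1}"
    and F: "\<And>x. x \<in> {0..1} \<Longrightarrow> c + integral {0..x} f = F x"
  shows "abs_cont F"
proof (rule abs_cont_lipschitz[OF abs_cont_integral[OF f] abs_cont_integral[OF f], of 1])
  fix s t :: real assume "0 \<le> s" "s \<le> t" "t \<le> 1"
  then show "norm (F t - F s) \<le> 1 * (norm (integral {0..t} f - integral {0..s} f) + norm (integral {0..t} f - integral {0..s} f))"
    using F[of s] F[of t] by (simp flip: F)
qed simp

lemma negligible_not_deriv:
  fixes F :: "real \<Rightarrow> 'a::euclidean_space"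
  assumes f: "f absolutely_integrable_on {0..1}"
    and F: "\<And>x. x \<in> {0..1} \<Longrightarrow> c + integral {0..x} f = F x"
  shows "negligible {x \<in> {0..1}. \<not> (F has_vector_derivative f x) (at x within {0..1})}"
proof (rule negligible_subset[OF lebesgue_differentiation[OF set_lebesgue_integral_eq_integral(1)[OF f]]])
  have "(F has_vector_derivative f x) (at x within {0..1})"
    if x: "x \<in> {0..1}" and d: "((\<lambda>x. integral {0..x} f) has_vector_derivative f x) (at x within {0..1})" for x
  proof -
    have "((\<lambda>x. c + integral {0..x} f) has_vector_derivative 0 + f x) (at x within {0..1})"
      by (intro has_vector_derivative_add has_vector_derivative_const d)
    then have "((\<lambda>x. c + integral {0..x} f) has_vector_derivative f x) (at x within {0..1})" by simp
    then show ?thesis by (rule has_vector_derivative_transform[OF x F[symmetric], rotated])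
  qed
  then show "{x \<in> {0..1}. \<not> (F has_vector_derivative f x) (at x within {0..1})}
      \<subseteq> {x \<in> {0..1}. \<not> ((\<lambda>x. integral {0..x} f) has_vector_derivative f x) (at x within {0..1})}"
    by blast
qed

lemma continuous_negligible_zero:
  fixes f :: "real \<Rightarrow> 'a::euclidean_space"
  assumes f: "continuous_on {0..1} f" and N: "negligible {x \<in> {0..1}. f x \<noteq> 0}" and x: "x \<in> {0..1}"
  shows "f x = 0"
proof -
  have c: "continuous_on {0..1} (\<lambda>s. norm (f s))" by (intro continuous_intros f)
  have "integral {0..1} (\<lambda>s. norm (f s)) = 0"
    by (intro integral_unique has_integral_negligible[OF N]) auto
  then show ?thesis using integral_eq_0_iff[OF c] x by simp
qed

context singular_SL
begin

lemma solution_abs_cont: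
  assumes "g absolutely_integrable_on {0..1}" "solution \<mu> g Y"
  shows "abs_cont Y"
  by (rule abs_cont_integral_eq[OF field_integrable[OF assms(1) solution_continuous[OF assms(2)]]
        solution_eq[OF assms(2)]])

lemma solution_negligible:
  assumes "g absolutely_integrable_on {0..1}" "solution \<mu> g Y"
  shows "negligible {x \<in> {0..1}. \<not> (Y has_vector_derivative field \<mu> g x (Y x)) (at x within {0..1})}"
  by (rule negligible_not_deriv[OF field_integrable[OF assms(1) solution_continuous[OF assms(2)]]
        solution_eq[OF assms(2)]])

text \<open>If y vanishes identically, the first row of the system gives u = 0 almost everywhere,
  hence everywhere by continuity, and then the second row leaves g = 0. Thus y alone determines u
  and the forcing; well-definedness of A and non-triviality of eigenfunctions rest on this.\<close>

lemma solution_fst_zero: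
  assumes g: "g absolutely_integrable_on {0..1}" and Y: "solution \<mu> g Y"
    and 0: "\<And>x. x \<in> {0..1} \<Longrightarrow> fst (Y x) = 0"
  shows "x \<in> {0..1} \<Longrightarrow> snd (Y x) = 0" "negligible {x \<in> {0..1}. g x \<noteq> 0}"
proof -
  define N where "N = {x \<in> {0..1}. \<not> (Y has_vector_derivative field \<mu> g x (Y x)) (at x within {0..1})}"
  have N: "negligible N" unfolding N_def by (rule solution_negligible[OF g Y])
  have zero: "F' = 0"
    if F: "(F has_vector_derivative F') (at x within {0..1})" and x: "x \<in> {0..1}"
      and F0: "\<And>x. x \<in> {0..1} \<Longrightarrow> F x = 0" for F :: "real \<Rightarrow> complex" and F' x
  proof -
    have "(F has_vector_derivative 0) (at x within {0..1})"
      by (rule has_vector_derivative_transform[OF x F0 has_vector_derivative_const])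
    then show ?thesis
      using vector_derivative_unique_within_closed_interval[of 0 1 x F] F x by auto
  qed
  have u: "snd (Y x) = 0" if x: "x \<in> {0..1} - N" for x
  proof -
    have d: "(Y has_vector_derivative field \<mu> g x (Y x)) (at x within {0..1})" using x by (simp add: N_def)
    have "fst (field \<mu> g x (Y x)) = 0"
      using x 0 by (intro zero[OF bounded_linear.has_vector_derivative[OF bounded_linear_fst d]]) auto
    then show ?thesis using x 0 by (simp add: field_def)
  qed
  have sY: "continuous_on {0..1} (\<lambda>s. snd (Y s))" by (intro continuous_intros solution_continuous[OF Y])
  have u0: "snd (Y x) = 0" if "x \<in> {0..1}" for x
    by (rule continuous_negligible_zero[OF sY _ that]) (rule negligible_subset[OF N], use u in auto)
  then show "x \<in> {0..1} \<Longrightarrow> snd (Y x) = 0" by blast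
  have "g x = 0" if x: "x \<in> {0..1} - N" for x
  proof -
    have d: "(Y has_vector_derivative field \<mu> g x (Y x)) (at x within {0..1})" using x by (simp add: N_def)
    have "snd (field \<mu> g x (Y x)) = 0"
      using x u0 by (intro zero[OF bounded_linear.has_vector_derivative[OF bounded_linear_snd d]]) auto
    then show ?thesis using x 0 u0 by (simp add: field_def)
  qed
  then show "negligible {x \<in> {0..1}. g x \<noteq> 0}" by (intro negligible_subset[OF N]) auto
qed

text \<open>A solution \<open>v\<close> of this linear equation turns the indefinite term \<open>r\<^sup>2 \<bar>y\<bar>\<^sup>2\<close> of the
  quadratic form of the operator into a total derivative.\<close>

lemma energy_multiplier:
  obtains v :: "real \<Rightarrow> real" where "continuous_on {0..1} v" "abs_cont v"
    "negligible {x \<in> {0..1}. \<not> (v has_vector_derivative ((r x)\<^sup>2 - 2 * r x * v x)) (at x within {0..1})}"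
proof -
  define F where "F s v = (r s)\<^sup>2 - 2 * r s * v" for s and v :: real
  have rv: "(\<lambda>s. 2 * r s * \<phi> s) absolutely_integrable_on {0..1}" if "continuous_on {0..1} \<phi>" for \<phi> :: "real \<Rightarrow> real"
    using set_integrable_mult_right[OF absolutely_integrable_continuous_product[OF bounded_bilinear_mult that r_int], of 2]
    by (simp add: mult_ac)
  have F: "(\<lambda>s. F s (\<phi> s)) absolutely_integrable_on {0..1}" if "continuous_on {0..1} \<phi>" for \<phi>
    unfolding F_def by (intro set_integral_diff r2_int rv[OF that])
  have lip: "norm (F s v - F s w) \<le> 2 * \<bar>r s\<bar> * norm (v - w)" for s v w
  proof -
    have "F s v - F s w = - (2 * r s * (v - w))" by (simp add: F_def algebra_simps)
    then show ?thesis by (simp add: abs_mult)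
  qed
  have m: "(\<lambda>s. 2 * \<bar>r s\<bar>) absolutely_integrable_on {0..1}"
    by (intro set_integrable_mult_right set_integrable_abs r_int)
  show thesis
  \<comment> \<open>The initial value of v is arbitrary, since v is multiplied by |y|^2, which
    vanishes at both end points in the application.\<close>
  proof (rule caratheodory_exists[where c = 0, OF F lip m])
    fix v assume v: "continuous_on {0..1} v" "\<And>x. x \<in> {0..1} \<Longrightarrow> v x = 0 + integral {0..x} (\<lambda>s. F s (v s))"
    show thesis
    proof (rule that[OF v(1)])
      show "abs_cont v" by (rule abs_cont_integral_eq[OF F[OF v(1)] v(2)[symmetric]])
      show "negligible {x \<in> {0..1}. \<not> (v has_vector_derivative ((r x)\<^sup>2 - 2 * r x * v x)) (at x within {0..1})}"
        using negligible_not_deriv[OF F[OF v(1)] v(2)[symmetric]] by (simp only: F_def)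
    qed
  qed auto
qed

lemma characteristic_nonzero: "\<exists>\<mu>. characteristic \<mu> \<noteq> 0"
proof -
  obtain v :: "real \<Rightarrow> real" where vc: "continuous_on {0..1} v" and va: "abs_cont v"
    and vn: "negligible {x \<in> {0..1}. \<not> (v has_vector_derivative ((r x)\<^sup>2 - 2 * r x * v x)) (at x within {0..1})}"
    by (rule energy_multiplier)
  obtain V where V: "\<And>s. s \<in> {0..1} \<Longrightarrow> \<bar>v s\<bar> \<le> V"
    using compact_imp_bounded[OF compact_continuous_image[OF vc]]
    unfolding bounded_iff real_norm_def by blast
  have V0: "V \<ge> 0" by (rule order_trans[OF abs_ge_zero V[of 0]]) simp
  \<comment> \<open>Chosen so that \<tau>^2 - V^2 = 2 V + 1 \<ge> 1.\<close>
  define \<tau> where "\<tau> = V + 1"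
  define \<mu> where "\<mu> = \<i> * complex_of_real \<tau>"
  define Y where "Y = fund \<mu>"
  have Ysol: "solution \<mu> (\<lambda>s. 0) Y" and Y0: "Y 0 = (0, 1)" using fund by (auto simp: Y_def)
  have Yc: "continuous_on {0..1} Y" by (rule solution_continuous[OF Ysol])
  have Ya: "abs_cont Y" by (rule solution_abs_cont[OF zero_int Ysol])
  have "characteristic \<mu> \<noteq> 0"
  proof
    assume "characteristic \<mu> = 0"
    then have Y1: "fst (Y 1) = 0" by (simp add: characteristic_def Y_def)
    obtain B where B: "\<And>s. s \<in> {0..1} \<Longrightarrow> norm (Y s) \<le> B"
      using compact_imp_bounded[OF compact_continuous_image[OF Yc]] unfolding bounded_iff by blast
    have B0: "B \<ge> 0" by (rule order_trans[OF norm_ge_zero B[of 0]]) simp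
    define w where "w s = Re (snd (Y s) * cnj (fst (Y s)) + of_real (v s) * (fst (Y s) * cnj (fst (Y s))))" for s
    define w' where "w' s = (cmod (snd (Y s)))\<^sup>2 + \<tau>\<^sup>2 * (cmod (fst (Y s)))\<^sup>2
        + 2 * v s * Re (snd (Y s) * cnj (fst (Y s)))" for s
    have wa: "abs_cont w"
    proof (rule abs_cont_lipschitz[OF Ya va])
      \<comment> \<open>The summands come from varying y and u in u cnj y, y in v |y|^2, and v in v
        |y|^2; the 1 makes the constant positive even if the others vanish.\<close>
      show "2 * B + 2 * V * B + B\<^sup>2 + 1 > 0" using B0 V0 by (simp add: add_nonneg_pos)
      fix s t :: real assume st: "0 \<le> s" "s \<le> t" "t \<le> 1"
      define a a' b b' where "a = fst (Y s)" and "a' = fst (Y t)" and "b = snd (Y s)" and "b' = snd (Y t)"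
      have ab: "cmod a \<le> B" "cmod a' \<le> B" "cmod b \<le> B" "cmod b' \<le> B"
        using B[of s] B[of t] st norm_fst_le[of a b] norm_snd_le[of b a] norm_fst_le[of a' b'] norm_snd_le[of b' a']
        by (auto simp: a_def a'_def b_def b'_def)
      define \<Delta> where "\<Delta> = norm (Y t - Y s)"
      have D: "cmod (a' - a) \<le> \<Delta>" "cmod (b' - b) \<le> \<Delta>"
        using norm_fst_le[of "a' - a" "b' - b"] norm_snd_le[of "b' - b" "a' - a"]
        by (auto simp: \<Delta>_def a_def a'_def b_def b'_def minus_prod_def)
      have \<Delta>0: "\<Delta> \<ge> 0" by (simp add: \<Delta>_def)
      have vs: "\<bar>v s\<bar> \<le> V" using V st by auto
      have "w t - w s = Re ((b' * cnj (a' - a) + (b' - b) * cnj a)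
          + of_real (v s) * (a' * cnj (a' - a) + (a' - a) * cnj a) + of_real (v t - v s) * (a' * cnj a'))"
        by (simp add: w_def a_def a'_def b_def b'_def algebra_simps)
      also have "norm \<dots> \<le> cmod ((b' * cnj (a' - a) + (b' - b) * cnj a)
          + of_real (v s) * (a' * cnj (a' - a) + (a' - a) * cnj a) + of_real (v t - v s) * (a' * cnj a'))"
        unfolding real_norm_def by (rule abs_Re_le_cmod)
      also have "\<dots> \<le> ((cmod b' * cmod (a' - a) + cmod (b' - b) * cmod a)
          + \<bar>v s\<bar> * (cmod a' * cmod (a' - a) + cmod (a' - a) * cmod a)) + \<bar>v t - v s\<bar> * (cmod a' * cmod a')"
        by (intro norm_triangle_le add_mono)
          (auto simp: norm_mult intro!: mult_left_mono norm_triangle_le simp flip: of_real_diff complex_cnj_diff)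
      also have "\<dots> \<le> ((B * \<Delta> + \<Delta> * B) + V * (B * \<Delta> + \<Delta> * B)) + \<bar>v t - v s\<bar> * (B * B)"
        using ab D vs B0 V0 \<Delta>0 by (intro add_mono mult_mono) auto
      also have "\<dots> \<le> (2 * B + 2 * V * B + B\<^sup>2 + 1) * (\<Delta> + \<bar>v t - v s\<bar>)"
      proof -
        have "(2 * B + 2 * V * B + B\<^sup>2 + 1) * (\<Delta> + \<bar>v t - v s\<bar>)
          - (((B * \<Delta> + \<Delta> * B) + V * (B * \<Delta> + \<Delta> * B)) + \<bar>v t - v s\<bar> * (B * B))
          = (B\<^sup>2 + 1) * \<Delta> + (2 * B + 2 * V * B + 1) * \<bar>v t - v s\<bar>"
          by (simp add: algebra_simps power2_eq_square)
        moreover have "\<dots> \<ge> 0" using B0 V0 \<Delta>0 by (intro add_nonneg_nonneg mult_nonneg_nonneg) auto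
        ultimately show ?thesis by linarith
      qed
      finally show "norm (w t - w s) \<le> (2 * B + 2 * V * B + B\<^sup>2 + 1) * (norm (Y t - Y s) + norm (v t - v s))"
        by (simp add: \<Delta>_def)
    qed
    define N where "N = {x \<in> {0..1}. \<not> (Y has_vector_derivative field \<mu> (\<lambda>s. 0) x (Y x)) (at x within {0..1})}
      \<union> {x \<in> {0..1}. \<not> (v has_vector_derivative ((r x)\<^sup>2 - 2 * r x * v x)) (at x within {0..1})}"
    have N: "negligible N"
      unfolding N_def using solution_negligible[OF zero_int Ysol] vn by (rule negligible_Un)
    have der: "(w has_vector_derivative w' x) (at x within {0..1})" if x: "x \<in> {0..1} - N" for x
    proof -
      define f where "f = field \<mu> (\<lambda>s. 0) x (Y x)"
      have dY: "(Y has_vector_derivative f) (at x within {0..1})"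
        and dv: "(v has_vector_derivative ((r x)\<^sup>2 - 2 * r x * v x)) (at x within {0..1})"
        using x by (auto simp: N_def f_def)
      note dy = bounded_linear.has_vector_derivative[OF bounded_linear_fst dY]
      note du = bounded_linear.has_vector_derivative[OF bounded_linear_snd dY]
      note dc = bounded_linear.has_vector_derivative[OF bounded_linear_cnj dy]
      note dvc = bounded_linear.has_vector_derivative[OF bounded_linear_of_real dv]
      have "(w has_vector_derivative Re ((snd (Y x) * cnj (fst f) + snd f * cnj (fst (Y x)))
          + (of_real (v x) * (fst (Y x) * cnj (fst f) + fst f * cnj (fst (Y x)))
            + of_real ((r x)\<^sup>2 - 2 * r x * v x) * (fst (Y x) * cnj (fst (Y x)))))) (at x within {0..1})"
        unfolding w_def
        by (intro bounded_linear.has_vector_derivative[OF bounded_linear_Re] has_vector_derivative_add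
            has_vector_derivative_mult du dy dc dvc)
      also have "Re ((snd (Y x) * cnj (fst f) + snd f * cnj (fst (Y x)))
          + (of_real (v x) * (fst (Y x) * cnj (fst f) + fst f * cnj (fst (Y x)))
            + of_real ((r x)\<^sup>2 - 2 * r x * v x) * (fst (Y x) * cnj (fst (Y x))))) = w' x"
        by (simp add: f_def field_def w'_def \<mu>_def cmod_power2 power_mult_distrib algebra_simps)
          (simp add: algebra_simps power2_eq_square)
      finally show ?thesis .
    qed
    have "(w' has_integral (w 1 - w 0)) {0..1}"
      by (rule fundamental_theorem_of_calculus_abs_cont[OF wa N _ _ der]) auto
    then have w': "(w' has_integral 0) {0..1}" by (simp add: w_def Y0 Y1)
    have le: "(cmod (fst (Y s)))\<^sup>2 \<le> w' s" if s: "s \<in> {0..1}" for s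
    proof -
      define a b where "a = cmod (fst (Y s))" and "b = cmod (snd (Y s))"
      have "\<bar>Re (snd (Y s) * cnj (fst (Y s)))\<bar> \<le> a * b"
        using abs_Re_le_cmod[of "snd (Y s) * cnj (fst (Y s))"] by (simp add: norm_mult a_def b_def mult.commute)
      then have "\<bar>v s * Re (snd (Y s) * cnj (fst (Y s)))\<bar> \<le> V * (a * b)"
        unfolding abs_mult using V[OF s] V0 by (intro mult_mono) auto
      then have "w' s \<ge> b\<^sup>2 + \<tau>\<^sup>2 * a\<^sup>2 - 2 * (V * (a * b))"
        unfolding w'_def a_def b_def by linarith
      \<comment> \<open>Completing the square in b; the rest is (\<tau>^2 - V^2) a^2 by the choice
        of \<tau>.\<close>
      also have "b\<^sup>2 + \<tau>\<^sup>2 * a\<^sup>2 - 2 * (V * (a * b)) = (b - V * a)\<^sup>2 + 2 * V * a\<^sup>2 + a\<^sup>2"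
        by (simp add: \<tau>_def algebra_simps power2_eq_square)
      finally have "w' s \<ge> (b - V * a)\<^sup>2 + 2 * V * a\<^sup>2 + a\<^sup>2" .
      moreover have "(b - V * a)\<^sup>2 \<ge> 0" "2 * V * a\<^sup>2 \<ge> 0" using V0 by auto
      ultimately show ?thesis unfolding a_def by linarith
    qed
    have yc: "continuous_on {0..1} (\<lambda>s. (cmod (fst (Y s)))\<^sup>2)" by (intro continuous_intros Yc)
    have "integral {0..1} (\<lambda>s. (cmod (fst (Y s)))\<^sup>2) \<le> 0"
      using has_integral_le[OF integrable_integral[OF integrable_continuous_real[OF yc]] w' le] by simp
    moreover have "integral {0..1} (\<lambda>s. (cmod (fst (Y s)))\<^sup>2) \<ge> 0"
      by (intro integral_nonneg integrable_continuous_real yc) auto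
    ultimately have "integral {0..1} (\<lambda>s. (cmod (fst (Y s)))\<^sup>2) = 0" by linarith
    then have "\<forall>s\<in>{0..1}. (cmod (fst (Y s)))\<^sup>2 = 0"
      using integral_eq_0_iff[OF yc] by simp
    then have "fst (Y s) = 0" if "s \<in> {0..1}" for s using that by auto
    \<comment> \<open>A vanishing first component would force u(0) = 0, against the initial value
      u(0) = 1.\<close>
    from solution_fst_zero(1)[OF zero_int Ysol this, of 0] show False using Y0 by simp
  qed
  then show ?thesis by blast
qed

end

section \<open>Elements of $L_2(0,1)$ and solutions\<close>

lemma AE_leb01_iff: "(AE x in leb01. P x) \<longleftrightarrow> negligible {x \<in> {0..1}. \<not> P x}"
proof -
  have "(AE x in leb01. P x) \<longleftrightarrow> (AE x in lebesgue. x \<in> {0..1} \<longrightarrow> P x)"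
    by (subst AE_restrict_space_iff) auto
  also have "\<dots> \<longleftrightarrow> {x \<in> {0..1}. \<not> P x} \<in> null_sets lebesgue"
    by (subst completion.AE_iff_null_sets) (simp add: conj_ac)
  finally show ?thesis by (simp add: negligible_iff_null_sets)
qed

text \<open>Measurability survives the change because Lebesgue measure is complete.\<close>

lemma sq_integrable_cong_AE:
  fixes f g :: "real \<Rightarrow> complex"
  assumes f: "sq_integrable f" and eq: "AE x in leb01. f x = g x"
  shows "sq_integrable g"
proof -
  have N: "negligible {x \<in> {0..1}. f x \<noteq> g x}" using eq by (simp add: AE_leb01_iff)
  have fm: "f \<in> borel_measurable leb01" and i: "integrable leb01 (\<lambda>x. (norm (f x))\<^sup>2)"
    using f by (auto simp: sq_integrable_def)
  have gm: "g \<in> borel_measurable leb01"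
  proof -
    have "(\<lambda>x. if x \<in> {0..1} then f x else 0) \<in> borel_measurable lebesgue"
      using fm borel_measurable_if[of "{0..1}" f] by simp
    moreover have "AE x in lebesgue. (if x \<in> {0..1} then f x else 0) = (if x \<in> {0..1} then g x else 0)"
      using eq by (subst (asm) AE_restrict_space_iff) auto
    ultimately have "(\<lambda>x. if x \<in> {0..1} then g x else 0) \<in> borel_measurable lebesgue"
      by (rule borel_measurable_AE)
    then show ?thesis using borel_measurable_if[of "{0..1}" g] by simp
  qed
  have "integrable leb01 (\<lambda>x. (norm (g x))\<^sup>2)"
    by (rule integrable_cong_AE_imp[OF i]) (use gm eq in auto)
  then show ?thesis using gm by (simp add: sq_integrable_def)
qed

lemma sq_integrable_continuous_product:
  fixes y :: "real \<Rightarrow> complex"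
  assumes y: "continuous_on {0..1} y" and p: "sq_integrable (p :: real \<Rightarrow> real)"
  shows "sq_integrable (\<lambda>x. of_real (p x) * y x)"
proof -
  have pm: "p \<in> borel_measurable leb01" using p by (auto simp: sq_integrable_def)
  have ym: "y \<in> borel_measurable leb01"
    using y by (intro continuous_imp_measurable_on_sets_lebesgue) auto
  have "continuous_on {0..1} (\<lambda>x. (norm (y x))\<^sup>2)" by (intro continuous_intros y)
  then have "(\<lambda>x. (norm (y x))\<^sup>2 * (norm (p x))\<^sup>2) absolutely_integrable_on {0..1}"
    by (rule absolutely_integrable_continuous_product[OF bounded_bilinear_mult _ sq_integrable_imp_absolutely_integrable(2)[OF p]])
  then have "integrable leb01 (\<lambda>x. (norm (y x))\<^sup>2 * (norm (p x))\<^sup>2)"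
    by (simp add: set_integrable_def integrable_restrict_space)
  moreover have "(\<lambda>x. of_real (p x) * y x) \<in> borel_measurable leb01"
    using pm ym by measurable
  ultimately show ?thesis by (simp add: sq_integrable_def norm_mult power_mult_distrib mult.commute)
qed

lemma sq_integrable_continuous:
  fixes y :: "real \<Rightarrow> complex"
  assumes y: "continuous_on {0..1} y"
  shows "sq_integrable y"
proof -
  have "sq_integrable (\<lambda>x::real. 1::real)"
    using absolutely_integrable_continuous_real[of 0 1 "\<lambda>_. 1::real"]
    by (simp add: sq_integrable_def set_integrable_def integrable_restrict_space)
  from sq_integrable_continuous_product[OF y this] show ?thesis by simp
qed

lemma L2_eq_refl: "sq_integrable f \<Longrightarrow> L2_eq f f"
  by (simp add: L2_eq_def)

lemma abs_L2_eq_iff: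
  assumes "sq_integrable f" "sq_integrable g"
  shows "abs_L2 f = abs_L2 g \<longleftrightarrow> (AE x in leb01. f x = g x)"
  using Quotient3_rel[OF Quotient3_L2, of f g] assms by (auto simp: L2_eq_def)

lemma abs_L2_cong:
  assumes "sq_integrable f" "\<And>x. x \<in> {0..1} \<Longrightarrow> f x = g x"
  shows "abs_L2 f = abs_L2 g"
proof -
  have eq: "AE x in leb01. f x = g x" using assms(2) by (intro AE_I2) auto
  show ?thesis using abs_L2_eq_iff[OF assms(1) sq_integrable_cong_AE[OF assms(1) eq]] eq by simp
qed

lemma L2_cases:
  obtains g where "sq_integrable g" "G = abs_L2 g"
proof (rule that)
  show "sq_integrable (rep_L2 G)"
    using Quotient3_rel_rep[OF Quotient3_L2, of G G] by (simp add: L2_eq_def)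
  show "G = abs_L2 (rep_L2 G)" by (simp add: Quotient3_abs_rep[OF Quotient3_L2])
qed

lemma L2_plus: "sq_integrable f \<Longrightarrow> sq_integrable g \<Longrightarrow> abs_L2 f + abs_L2 g = abs_L2 (\<lambda>x. f x + g x)"
  by (simp add: plus_L2.abs_eq L2_eq_refl)

lemma L2_minus:
  assumes "sq_integrable f" "sq_integrable g"
  shows "abs_L2 f - abs_L2 g = abs_L2 (\<lambda>x. f x - g x)"
proof -
  have "sq_integrable (\<lambda>x. - g x)" using sq_integrable_mult_left[OF assms(2), of "-1"] by simp
  then show ?thesis
    using assms by (simp add: minus_L2_def uminus_L2.abs_eq L2_eq_refl L2_plus)
qed

lemma L2_scaleC: "sq_integrable f \<Longrightarrow> c *\<^sub>C abs_L2 f = abs_L2 (\<lambda>x. c * f x)"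
  by (simp add: scaleC_L2.abs_eq L2_eq_refl)

lemma L2_scaleR: "sq_integrable f \<Longrightarrow> c *\<^sub>R abs_L2 f = abs_L2 (\<lambda>x. of_real c * f x)"
  by (simp add: scaleR_L2.abs_eq L2_eq_refl)

lemma sq_integrable_diff:
  fixes f g :: "real \<Rightarrow> complex"
  assumes "sq_integrable f" "sq_integrable g"
  shows "sq_integrable (\<lambda>x. f x - g x)"
  using sq_integrable_add[OF assms(1) sq_integrable_mult_left[OF assms(2), of "-1"]] by simp

lemma norm_L2_le:
  assumes y: "sq_integrable y" and C: "C \<ge> 0" "\<And>x. x \<in> {0..1} \<Longrightarrow> cmod (y x) \<le> C"
  shows "norm (abs_L2 y) \<le> C"
proof -
  have i: "(\<lambda>x. (cmod (y x))\<^sup>2) absolutely_integrable_on {0..1}"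
    by (rule sq_integrable_imp_absolutely_integrable(2)[OF y])
  have "(LINT x|leb01. (cmod (y x))\<^sup>2) = integral {0..1} (\<lambda>x. (cmod (y x))\<^sup>2)"
    using set_lebesgue_integral_eq_integral(2)[OF i]
    by (simp add: set_lebesgue_integral_def integral_restrict_space)
  also have "\<dots> \<le> integral {0..1} (\<lambda>x::real. C\<^sup>2)"
  proof (rule integral_le)
    show "(cmod (y x))\<^sup>2 \<le> C\<^sup>2" if "x \<in> {0..1}" for x
      using C(2)[OF that] by (intro power_mono) auto
  qed (use set_lebesgue_integral_eq_integral(1)[OF i] in auto)
  also have "\<dots> = C\<^sup>2" by simp
  finally show ?thesis
    using y C(1) by (simp add: norm_L2.abs_eq L2_eq_refl L2_seminorm_def real_le_lsqrt)
qed

text \<open>Cauchy-Schwarz against the constant 1, obtained by integrating 2 c |g| - c^2 \<le> |g|^2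
  for the mean c of |g|. It converts the integral norm of the forcing in
  \<open>solution_bound\<close> into the norm of the Hilbert space.\<close>

lemma integral_cmod_le_norm:
  assumes g: "sq_integrable g"
  shows "integral {0..1} (\<lambda>s. cmod (g s)) \<le> norm (abs_L2 g)"
proof -
  define c where "c = integral {0..1} (\<lambda>s. cmod (g s))"
  have i2: "(\<lambda>x. (cmod (g x))\<^sup>2) absolutely_integrable_on {0..1}"
    by (rule sq_integrable_imp_absolutely_integrable(2)[OF g])
  have i1: "(\<lambda>x. cmod (g x)) integrable_on {0..1}"
    using absolutely_integrable_norm[OF sq_integrable_imp_absolutely_integrable(1)[OF g]]
    by (simp add: o_def set_lebesgue_integral_eq_integral(1))
  have c0: "c \<ge> 0" unfolding c_def by (intro integral_nonneg i1) auto
  have I: "((\<lambda>x. 2 * c * cmod (g x) - c\<^sup>2) has_integral (2 * c * c - c\<^sup>2)) {0..1}"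
    using has_integral_diff[OF has_integral_mult_right[OF integrable_integral[OF i1], of "2 * c"]
        has_integral_const_real[of "c\<^sup>2" 0 1]] by (simp add: c_def)
  have "2 * c * c - c\<^sup>2 \<le> integral {0..1} (\<lambda>x. (cmod (g x))\<^sup>2)"
  proof (rule has_integral_le[OF I integrable_integral[OF set_lebesgue_integral_eq_integral(1)[OF i2]]])
    show "2 * c * cmod (g x) - c\<^sup>2 \<le> (cmod (g x))\<^sup>2" for x
      using zero_le_power2[of "cmod (g x) - c"] by (simp add: power2_diff mult_ac)
  qed
  then have "c\<^sup>2 \<le> integral {0..1} (\<lambda>x. (cmod (g x))\<^sup>2)" by (simp add: power2_eq_square)
  also have "\<dots> = (LINT x|leb01. (cmod (g x))\<^sup>2)"
    using set_lebesgue_integral_eq_integral(2)[OF i2]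
    by (simp add: set_lebesgue_integral_def integral_restrict_space)
  finally have "c \<le> sqrt (LINT x|leb01. (cmod (g x))\<^sup>2)" by (rule real_le_rsqrt)
  then show ?thesis using g by (simp add: norm_L2.abs_eq L2_eq_refl L2_seminorm_def c_def)
qed

lemma abs_cont_contraction:
  assumes "abs_cont f" "\<And>s t. norm (w t - w s) \<le> norm (f t - f s)"
  shows "abs_cont w"
  using abs_cont_lipschitz[OF assms(1,1), of 1 w] order_trans[OF assms(2)] by simp

lemma norm_fst_snd_le: "norm (fst v) \<le> norm v" "norm (snd v) \<le> norm v"
  using norm_fst_le[of "fst v" "snd v"] norm_snd_le[of "snd v" "fst v"] by simp_all

section \<open>The differential expression and the first order system\<close>

context singular_SL
begin

text \<open>The forcing enters only through integrals, so any representative of an element of L_2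
  may be used.\<close>

lemma solution_cong_AE:
  assumes Y: "solution \<mu> g Y" and eq: "AE x in leb01. g x = h x"
  shows "solution \<mu> h Y"
  unfolding solution_def
proof (intro conjI ballI solution_continuous[OF Y])
  fix x :: real assume x: "x \<in> {0..1}"
  have "integral {0..x} (\<lambda>s. field \<mu> g s (Y s)) = integral {0..x} (\<lambda>s. field \<mu> h s (Y s))"
  proof (rule integral_spike)
    show "negligible {x \<in> {0..1}. g x \<noteq> h x}" using eq by (simp add: AE_leb01_iff)
    show "field \<mu> h s (Y s) = field \<mu> g s (Y s)" if "s \<in> {0..x} - {x \<in> {0..1}. g x \<noteq> h x}" for s
      using that x by (auto simp: field_def)
  qed
  then show "Y x = Y 0 + integral {0..x} (\<lambda>s. field \<mu> h s (Y s))"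
    using solution_eq[OF Y x] by (simp only:)
qed

text \<open>Absolute continuity is what permits integrating the almost everywhere equation. The
  parameter is 0 and the forcing -f because T(0) = -A.\<close>

lemma ell_graph_imp_solution:
  assumes "ell_graph r y f"
  obtains u where "sq_integrable f" "solution 0 (\<lambda>s. - f s) (\<lambda>s. (y s, u s))"
proof -
  obtain u u' y' where y: "abs_cont y" and u: "abs_cont u" and f: "sq_integrable f"
    and ae: "AE x in leb01. (y has_vector_derivative y' x) (at x)"
      "AE x in leb01. (u has_vector_derivative u' x) (at x)"
      "AE x in leb01. u x = y' x - of_real (r x) * y x"
      "AE x in leb01. f x = - u' x - of_real (r x) * u x - of_real ((r x)\<^sup>2) * y x"
    using assms unfolding ell_graph_def has_quasi_derivative_def has_ae_derivative_def abs_continuous01_iff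
    by blast
  define Y where "Y s = (y s, u s)" for s
  have Y: "abs_cont Y"
  proof (rule abs_cont_lipschitz[OF y u])
    show "norm (Y t - Y s) \<le> 1 * (norm (y t - y s) + norm (u t - u s))" for s t
      using norm_Pair_le[of "y t - y s" "u t - u s"] by (simp add: Y_def)
  qed simp
  have "AE x in leb01. (Y has_vector_derivative field 0 (\<lambda>s. - f s) x (Y x)) (at x)"
    using ae
  proof eventually_elim
    case (elim x)
    have "((\<lambda>s. (y s, u s)) has_vector_derivative (y' x, u' x)) (at x)"
      by (rule has_vector_derivative_Pair[OF elim(1,2)])
    moreover have "(y' x, u' x) = field 0 (\<lambda>s. - f s) x (Y x)"
      unfolding field_def Y_def elim(3,4) by (simp add: elim(3))
    ultimately show ?case by (simp add: Y_def [abs_def])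
  qed
  then have N: "negligible {x \<in> {0..1}. \<not> (Y has_vector_derivative field 0 (\<lambda>s. - f s) x (Y x)) (at x)}"
    by (simp add: AE_leb01_iff)
  have "solution 0 (\<lambda>s. - f s) Y"
    unfolding solution_def
  proof (intro conjI ballI abs_cont_continuous[OF Y])
    fix x :: real assume "x \<in> {0..1}"
    then have x: "0 \<le> x" "x \<le> 1" by auto
    have "((\<lambda>s. field 0 (\<lambda>s. - f s) s (Y s)) has_integral (Y x - Y 0)) {0..x}"
      by (rule fundamental_theorem_of_calculus_abs_cont[OF Y N x])
        (auto intro: has_vector_derivative_at_within)
    from integral_unique[OF this]
    show "Y x = Y 0 + integral {0..x} (\<lambda>s. field 0 (\<lambda>s. - f s) s (Y s))" by (simp add: algebra_simps)
  qed
  then show thesis using that f unfolding Y_def by blast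
qed

lemma solution_imp_ell_graph:
  assumes f: "sq_integrable f" and Y: "solution 0 (\<lambda>s. - f s) Y"
  shows "ell_graph r (\<lambda>s. fst (Y s)) f"
proof -
  have fi: "(\<lambda>s. - f s) absolutely_integrable_on {0..1}"
    using set_integrable_mult_right[OF sq_integrable_imp_absolutely_integrable(1)[OF f], of "-1"] by simp
  have Ya: "abs_cont Y" by (rule solution_abs_cont[OF fi Y])
  have ya: "abs_cont (\<lambda>s. fst (Y s))" and ua: "abs_cont (\<lambda>s. snd (Y s))"
    by (rule abs_cont_contraction[OF Ya], simp add: norm_fst_snd_le flip: fst_diff)
      (rule abs_cont_contraction[OF Ya], simp add: norm_fst_snd_le flip: snd_diff)
  define G where "G x = field 0 (\<lambda>s. - f s) x (Y x)" for x
  \<comment> \<open>\<open>has_ae_derivative\<close> asks for two-sided derivatives, whereas those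
    from the integral are relative to {0..1}; they agree except possibly at the end points, which
    join the null set.\<close>
  have "negligible ({x \<in> {0..1}. \<not> (Y has_vector_derivative G x) (at x within {0..1})} \<union> {0, 1})"
    unfolding G_def by (intro negligible_Un solution_negligible[OF fi Y] negligible_finite) simp
  then have "AE x in leb01. (Y has_vector_derivative G x) (at x)"
    unfolding AE_leb01_iff
  proof (rule negligible_subset, clarify)
    fix x :: real assume x: "x \<in> {0..1}" "\<not> (Y has_vector_derivative G x) (at x)" "x \<notin> {}" "x \<noteq> 1"
      "x \<noteq> 0" "(Y has_vector_derivative G x) (at x within {0..1})"
    then have "x \<in> interior {0..1}" by auto
    then have "at x within {0..1} = at x" by (rule at_within_interior)
    with x show False by simp
  qed
  note aeY = this
  have ae1: "AE x in leb01. ((\<lambda>s. fst (Y s)) has_vector_derivative fst (G x)) (at x)"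
    using aeY by eventually_elim (rule bounded_linear.has_vector_derivative[OF bounded_linear_fst])
  have ae2: "AE x in leb01. ((\<lambda>s. snd (Y s)) has_vector_derivative snd (G x)) (at x)"
    using aeY by eventually_elim (rule bounded_linear.has_vector_derivative[OF bounded_linear_snd])
  have "has_quasi_derivative r (\<lambda>s. fst (Y s)) (\<lambda>s. snd (Y s))"
    unfolding has_quasi_derivative_def has_ae_derivative_def abs_continuous01_iff
  proof (intro exI conjI ya ua)
    show "AE x in leb01. ((\<lambda>s. fst (Y s)) has_vector_derivative fst (G x)) (at x)" by (rule ae1)
    show "AE x in leb01. snd (Y x) = fst (G x) - of_real (r x) * fst (Y x)"
      by (intro AE_I2) (simp add: G_def field_def)
  qed
  moreover have "has_ae_derivative (\<lambda>s. snd (Y s)) (\<lambda>x. snd (G x))"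
    unfolding has_ae_derivative_def by (rule ae2)
  moreover have "AE x in leb01. f x = - snd (G x) - of_real (r x) * snd (Y x) - of_real ((r x)\<^sup>2) * fst (Y x)"
    by (intro AE_I2) (simp add: G_def field_def algebra_simps)
  ultimately show ?thesis unfolding ell_graph_def
    by (intro exI[of _ "\<lambda>s. snd (Y s)"] exI[of _ "\<lambda>x. snd (G x)"] conjI f)
qed

end

section \<open>The spectrum\<close>

lemma continuous_AE_eq:
  fixes f g :: "real \<Rightarrow> complex"
  assumes "continuous_on {0..1} f" "continuous_on {0..1} g" "AE x in leb01. f x = g x" "x \<in> {0..1}"
  shows "f x = g x"
proof -
  have "continuous_on {0..1} (\<lambda>x. f x - g x)" by (intro continuous_intros assms)
  moreover have "negligible {x \<in> {0..1}. f x - g x \<noteq> 0}"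
    using assms(3) by (simp add: AE_leb01_iff)
  ultimately have "f x - g x = 0" using assms(4) by (rule continuous_negligible_zero)
  then show ?thesis by simp
qed

context singular_SL
begin

lemma sq_integrable_int:
  assumes "sq_integrable (g :: real \<Rightarrow> complex)" shows "g absolutely_integrable_on {0..1}"
  using assms by (rule sq_integrable_imp_absolutely_integrable(1))

lemma sq_integrable_2p: "continuous_on {0..1} y \<Longrightarrow> sq_integrable (\<lambda>x. of_real (2 * p x) * (y x :: complex))"
  using sq_integrable_mult_left[OF sq_integrable_continuous_product[OF _ p], of y 2] by (simp add: mult.assoc)

text \<open>This justifies the definite description in \<open>op_A\<close>. Equal classes have the
  same continuous representative, so the difference of the two solutions has first component 0 and
  its forcing vanishes almost everywhere.\<close>

lemma ell_graph_unique:
  assumes e: "ell_graph r y f" "ell_graph r z h" and eq: "abs_L2 y = abs_L2 z"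
  shows "abs_L2 f = abs_L2 h"
proof -
  obtain u where f: "sq_integrable f" and u: "solution 0 (\<lambda>s. - f s) (\<lambda>s. (y s, u s))"
    by (rule ell_graph_imp_solution[OF e(1)])
  obtain v where h: "sq_integrable h" and v: "solution 0 (\<lambda>s. - h s) (\<lambda>s. (z s, v s))"
    by (rule ell_graph_imp_solution[OF e(2)])
  have c: "continuous_on {0..1} y" "continuous_on {0..1} z"
    using continuous_on_fst[OF solution_continuous[OF u]] continuous_on_fst[OF solution_continuous[OF v]] by simp_all
  have yz: "y x = z x" if "x \<in> {0..1}" for x
    using continuous_AE_eq[OF c _ that] eq
      abs_L2_eq_iff[OF sq_integrable_continuous[OF c(1)] sq_integrable_continuous[OF c(2)]] by blast
  have fi: "(\<lambda>s. - f s) absolutely_integrable_on {0..1}" "(\<lambda>s. - h s) absolutely_integrable_on {0..1}"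
    using set_integrable_mult_right[OF sq_integrable_int[OF f], of "-1"]
      set_integrable_mult_right[OF sq_integrable_int[OF h], of "-1"] by simp_all
  define g where "g s = 1 * - f s + (-1) * - h s" for s
  have g: "g absolutely_integrable_on {0..1}"
    unfolding g_def [abs_def] by (intro set_integral_add set_integrable_mult_right fi)
  have "solution 0 g (\<lambda>s. cscale 1 (y s, u s) + cscale (-1) (z s, v s))"
    unfolding g_def [abs_def] by (rule solution_combine[OF fi(1) u fi(2) v])
  from solution_fst_zero(2)[OF g this]
  have "negligible {x \<in> {0..1}. g x \<noteq> 0}" using yz by simp
  then have "negligible {x \<in> {0..1}. f x \<noteq> h x}" by (rule negligible_subset) (auto simp: g_def)
  then show ?thesis by (simp add: abs_L2_eq_iff[OF f h] AE_leb01_iff)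
qed

lemma op_A_eq:
  assumes "ell_graph r y f" "y 0 = 0" "y 1 = 0"
  shows "op_A r (abs_L2 y) = abs_L2 f"
  unfolding op_A_def
proof (rule the_equality)
  show "(abs_L2 y, abs_L2 f) \<in> graph_A r" using assms unfolding graph_A_def by blast
  fix F assume "(abs_L2 y, F) \<in> graph_A r"
  then obtain z h where "ell_graph r z h" "abs_L2 y = abs_L2 z" "F = abs_L2 h"
    unfolding graph_A_def by blast
  then show "F = abs_L2 f" using ell_graph_unique[OF assms(1)] by metis
qed

text \<open>\<open>op_B\<close> works on the representative picked by \<open>rep_L2\<close>, which
  is known to agree with y only off a null set.\<close>

lemma op_B_eq:
  assumes y: "continuous_on {0..1} y"
  shows "op_B p (abs_L2 y) = abs_L2 (\<lambda>x. of_real (2 * p x) * y x)"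
proof -
  have "L2_eq (rep_L2 (abs_L2 y)) y"
    by (rule Quotient3_rep_abs[OF Quotient3_L2]) (rule L2_eq_refl[OF sq_integrable_continuous[OF y]])
  then have "AE x in leb01. rep_L2 (abs_L2 y) x = y x" by (simp add: L2_eq_def)
  then have ae: "AE x in leb01. of_real (2 * p x) * y x = of_real (2 * p x) * rep_L2 (abs_L2 y) x"
    by eventually_elim simp
  show ?thesis
    unfolding op_B_def
    using abs_L2_eq_iff[OF sq_integrable_2p[OF y] sq_integrable_cong_AE[OF sq_integrable_2p[OF y] ae]] ae
    by simp
qed

section \<open>The Dirichlet problem for the first order system\<close>

definition bvp :: "complex \<Rightarrow> (real \<Rightarrow> complex) \<Rightarrow> (real \<Rightarrow> complex \<times> complex) \<Rightarrow> bool" where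
  "bvp \<mu> g Z \<longleftrightarrow> solution \<mu> g Z \<and> fst (Z 0) = 0 \<and> fst (Z 1) = 0"

lemma bvpD:
  assumes "bvp \<mu> g Z"
  shows "solution \<mu> g Z" "fst (Z 0) = 0" "fst (Z 1) = 0" "continuous_on {0..1} (\<lambda>s. fst (Z s))"
    "sq_integrable (\<lambda>s. fst (Z s))"
proof -
  show "solution \<mu> g Z" "fst (Z 0) = 0" "fst (Z 1) = 0" using assms unfolding bvp_def by blast+
  then show "continuous_on {0..1} (\<lambda>s. fst (Z s))" by (intro continuous_on_fst solution_continuous)
  then show "sq_integrable (\<lambda>s. fst (Z s))" by (rule sq_integrable_continuous)
qed

lemma pencil_T_eq:
  assumes e: "ell_graph r y f" and 0: "y 0 = 0" "y 1 = 0" and y: "continuous_on {0..1} y" and f: "sq_integrable f"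
  shows "pencil_T p r \<mu> (abs_L2 y) = abs_L2 (\<lambda>x. \<mu>\<^sup>2 * y x - \<mu> * (of_real (2 * p x) * y x) - f x)"
    "sq_integrable (\<lambda>x. \<mu>\<^sup>2 * y x - \<mu> * (of_real (2 * p x) * y x) - f x)"
proof -
  have s: "sq_integrable (\<lambda>x. \<mu>\<^sup>2 * y x)" "sq_integrable (\<lambda>x. \<mu> * (of_real (2 * p x) * y x))"
    by (intro sq_integrable_mult_left sq_integrable_continuous y sq_integrable_2p)+
  show "sq_integrable (\<lambda>x. \<mu>\<^sup>2 * y x - \<mu> * (of_real (2 * p x) * y x) - f x)"
    by (intro sq_integrable_diff s f)
  show "pencil_T p r \<mu> (abs_L2 y) = abs_L2 (\<lambda>x. \<mu>\<^sup>2 * y x - \<mu> * (of_real (2 * p x) * y x) - f x)"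
    unfolding pencil_T_def op_A_eq[OF e 0] op_B_eq[OF y]
    by (simp only: L2_scaleC sq_integrable_continuous[OF y] sq_integrable_2p[OF y] L2_minus s f sq_integrable_diff)
qed

text \<open>The dictionary between operator and system: injectivity, surjectivity and null space of
  T(\<mu>) all become statements about \<open>bvp\<close>. Both directions shift the parameter
  between 0, where \<open>ell_graph\<close> lives, and \<mu>.\<close>

lemma pencil_iff:
  assumes g: "sq_integrable g"
  shows "Y \<in> dom_A r \<and> pencil_T p r \<mu> Y = abs_L2 g \<longleftrightarrow>
    (\<exists>Z. bvp \<mu> g Z \<and> Y = abs_L2 (\<lambda>s. fst (Z s)))"
proof
  assume Y: "Y \<in> dom_A r \<and> pencil_T p r \<mu> Y = abs_L2 g"
  then obtain y f where y: "Y = abs_L2 y" and e: "ell_graph r y f" and 0: "y 0 = 0" "y 1 = 0"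
    unfolding dom_A_def graph_A_def by blast
  obtain u where f: "sq_integrable f" and u: "solution 0 (\<lambda>s. - f s) (\<lambda>s. (y s, u s))"
    by (rule ell_graph_imp_solution[OF e])
  have yc: "continuous_on {0..1} y" using continuous_on_fst[OF solution_continuous[OF u]] by simp
  note T = pencil_T_eq[OF e 0 yc f, of \<mu>]
  have "(\<lambda>s. - f s + (0 - \<mu>) * (2 * of_real (p s) - (0 + \<mu>)) * fst (y s, u s))
      = (\<lambda>x. \<mu>\<^sup>2 * y x - \<mu> * (of_real (2 * p x) * y x) - f x)"
    by (rule ext) (simp add: algebra_simps power2_eq_square)
  with solution_change_parameter[OF u, of \<mu>]
  have "solution \<mu> (\<lambda>x. \<mu>\<^sup>2 * y x - \<mu> * (of_real (2 * p x) * y x) - f x) (\<lambda>s. (y s, u s))" by (simp only:)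
  moreover have "AE x in leb01. \<mu>\<^sup>2 * y x - \<mu> * (of_real (2 * p x) * y x) - f x = g x"
    using T Y abs_L2_eq_iff[OF T(2) g] unfolding y by simp
  ultimately have "solution \<mu> g (\<lambda>s. (y s, u s))" by (rule solution_cong_AE)
  then have "bvp \<mu> g (\<lambda>s. (y s, u s))" using 0 unfolding bvp_def by simp
  then show "\<exists>Z. bvp \<mu> g Z \<and> Y = abs_L2 (\<lambda>s. fst (Z s))"
    using y by (intro exI[of _ "\<lambda>s. (y s, u s)"]) simp
next
  assume "\<exists>Z. bvp \<mu> g Z \<and> Y = abs_L2 (\<lambda>s. fst (Z s))"
  then obtain Z where Z: "bvp \<mu> g Z" and Y: "Y = abs_L2 (\<lambda>s. fst (Z s))" by blast
  note yc = bvpD(4)[OF Z]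
  define f where "f x = \<mu>\<^sup>2 * fst (Z x) - \<mu> * (of_real (2 * p x) * fst (Z x)) - g x" for x
  have f: "sq_integrable f"
    unfolding f_def [abs_def]
    by (intro sq_integrable_diff sq_integrable_mult_left sq_integrable_continuous yc sq_integrable_2p g)
  have "(\<lambda>s. g s + (\<mu> - 0) * (2 * of_real (p s) - (\<mu> + 0)) * fst (Z s)) = (\<lambda>s. - f s)"
    by (rule ext) (simp add: f_def algebra_simps power2_eq_square)
  with solution_change_parameter[OF bvpD(1)[OF Z], of 0]
  have "solution 0 (\<lambda>s. - f s) Z" by (simp only:)
  then have e: "ell_graph r (\<lambda>s. fst (Z s)) f" by (rule solution_imp_ell_graph[OF f])
  have "Y \<in> dom_A r" unfolding dom_A_def graph_A_def Y using e bvpD(2,3)[OF Z] by blast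
  moreover have "pencil_T p r \<mu> Y = abs_L2 g"
    using pencil_T_eq(1)[OF e bvpD(2,3)[OF Z] yc f, of \<mu>] unfolding Y by (simp add: f_def)
  ultimately show "Y \<in> dom_A r \<and> pencil_T p r \<mu> Y = abs_L2 g" by blast
qed

lemma bvp_combine:
  assumes "bvp \<mu> g Y" "g absolutely_integrable_on {0..1}" "bvp \<mu> h Z" "h absolutely_integrable_on {0..1}"
  shows "bvp \<mu> (\<lambda>s. a * g s + b * h s) (\<lambda>s. cscale a (Y s) + cscale b (Z s))"
  using solution_combine[OF assms(2) bvpD(1)[OF assms(1)] assms(4) bvpD(1)[OF assms(3)], of a b]
    bvpD(2,3)[OF assms(1)] bvpD(2,3)[OF assms(3)]
  unfolding bvp_def by simp

text \<open>Initial values with first component 0 form a complex line through that of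
  \<open>fund\<close>; uniqueness carries this over to the solutions. Simplicity of the eigenvalues
  comes from here.\<close>

lemma homogeneous_solution:
  assumes Z: "solution \<mu> (\<lambda>s. 0) Z" and 0: "fst (Z 0) = 0" and x: "x \<in> {0..1}"
  shows "Z x = cscale (snd (Z 0)) (fund \<mu> x)"
proof -
  have "solution \<mu> (\<lambda>s. snd (Z 0) * 0 + 0 * 0) (\<lambda>s. cscale (snd (Z 0)) (fund \<mu> s) + cscale 0 (fund \<mu> s))"
    by (rule solution_combine[OF zero_int fund(1) zero_int fund(1)])
  then have "solution \<mu> (\<lambda>s. 0) (\<lambda>s. cscale (snd (Z 0)) (fund \<mu> s) + cscale 0 (fund \<mu> s))" by simp
  from solution_unique[OF zero_int Z this _ x] show ?thesis
    using 0 by (simp add: fund(2) cscale_def prod_eq_iff)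
qed

lemma bvp_unique:
  assumes d: "characteristic \<mu> \<noteq> 0" and g: "g absolutely_integrable_on {0..1}"
    and Y: "bvp \<mu> g Y" and Z: "bvp \<mu> g Z" and x: "x \<in> {0..1}"
  shows "Y x = Z x"
proof -
  define W where "W s = cscale 1 (Y s) + cscale (-1) (Z s)" for s
  have "bvp \<mu> (\<lambda>s. 1 * g s + (-1) * g s) W"
    unfolding W_def [abs_def] by (rule bvp_combine[OF Y g Z g])
  then have W: "bvp \<mu> (\<lambda>s. 0) W" by simp
  note hom = homogeneous_solution[OF bvpD(1,2)[OF W]]
  have "snd (W 0) * characteristic \<mu> = 0"
    using hom[of 1] bvpD(3)[OF W] by (simp add: characteristic_def cscale_def prod_eq_iff)
  then have "snd (W 0) = 0" using d by simp
  then have "W x = 0" using hom[OF x] by (simp add: cscale_def zero_prod_def)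
  then show ?thesis by (simp add: W_def)
qed

lemma bvp_exists:
  assumes d: "characteristic \<mu> \<noteq> 0" and g: "g absolutely_integrable_on {0..1}"
  obtains Z where "bvp \<mu> g Z"
proof -
  obtain Y where Y: "solution \<mu> g Y" "Y 0 = 0" using solution_exists[OF g] by metis
  \<comment> \<open>Shooting: the multiple of \<open>fund\<close> that cancels the value of
    \<open>Y\<close> at the right end point.\<close>
  define c where "c = - fst (Y 1) / characteristic \<mu>"
  have "solution \<mu> (\<lambda>s. 1 * g s + c * 0) (\<lambda>s. cscale 1 (Y s) + cscale c (fund \<mu> s))"
    by (rule solution_combine[OF g Y(1) zero_int fund(1)])
  then have "bvp \<mu> g (\<lambda>s. cscale 1 (Y s) + cscale c (fund \<mu> s))"
    unfolding bvp_def using d by (simp add: Y(2) fund(2) c_def flip: characteristic_def)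
  then show thesis by (rule that)
qed

text \<open>Only the initial slope c of Z is unknown. Subtracting c times \<open>fund\<close> leaves
  a solution with zero initial value, so c times the characteristic value is bounded by the forcing;
  with c under control, \<open>solution_bound\<close> applies to Z itself.\<close>

lemma bvp_bound:
  assumes d: "characteristic \<mu> \<noteq> 0"
  shows "\<exists>C\<ge>0. \<forall>g Z. g absolutely_integrable_on {0..1} \<longrightarrow> bvp \<mu> g Z \<longrightarrow>
    (\<forall>x\<in>{0..1}. cmod (fst (Z x)) \<le> C * integral {0..1} (\<lambda>s. cmod (g s)))"
proof -
  define K where "K = 2 * exp (2 * integral {0..1} (weight (cmod \<mu>)))"
  have K0: "K \<ge> 0" by (simp add: K_def)
  define D where "D = cmod (characteristic \<mu>)"
  have D: "D > 0" using d by (simp add: D_def)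
  show ?thesis
  proof (intro exI[of _ "K * (K / D + 1)"] conjI allI impI ballI)
    show "K * (K / D + 1) \<ge> 0" using K0 D by simp
    fix g Z and x :: real
    assume g: "g absolutely_integrable_on {0..1}" and Z: "bvp \<mu> g Z" and x: "x \<in> {0..1}"
    define I where "I = integral {0..1} (\<lambda>s. cmod (g s))"
    define c where "c = snd (Z 0)"
    have c: "Z 0 = (0, c)" using bvpD(2)[OF Z] by (simp add: c_def prod_eq_iff)
    have "solution \<mu> (\<lambda>s. 1 * g s + (- c) * 0) (\<lambda>s. cscale 1 (Z s) + cscale (- c) (fund \<mu> s))"
      by (rule solution_combine[OF g bvpD(1)[OF Z] zero_int fund(1)])
    then have "solution \<mu> g (\<lambda>s. cscale 1 (Z s) + cscale (- c) (fund \<mu> s))" by simp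
    from solution_bound[OF g this order_refl, of 1]
    have "norm (cscale 1 (Z 1) + cscale (- c) (fund \<mu> 1)) \<le> K * (norm (cscale 1 (Z 0) + cscale (- c) (fund \<mu> 0)) + I)"
      by (simp add: K_def I_def)
    also have "cscale 1 (Z 0) + cscale (- c) (fund \<mu> 0) = 0"
      by (simp add: c fund(2) cscale_def zero_prod_def)
    finally have "norm (cscale 1 (Z 1) + cscale (- c) (fund \<mu> 1)) \<le> K * I" by simp
    then have "cmod (fst (cscale 1 (Z 1) + cscale (- c) (fund \<mu> 1))) \<le> K * I"
      by (rule order_trans[OF norm_fst_snd_le(1)])
    then have "cmod c * D \<le> K * I"
      using bvpD(3)[OF Z] by (simp add: norm_mult D_def characteristic_def)
    then have cI: "cmod c \<le> K * I / D" using D by (simp add: field_simps)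
    have "cmod (fst (Z x)) \<le> norm (Z x)" by (rule norm_fst_snd_le(1))
    also have "\<dots> \<le> K * (norm (Z 0) + I)"
      using solution_bound[OF g bvpD(1)[OF Z] order_refl x] by (simp only: K_def I_def)
    also have "\<dots> \<le> K * (K * I / D + I)"
      using cI K0 by (intro mult_left_mono add_right_mono) (simp_all add: c norm_Pair)
    also have "\<dots> = K * (K / D + 1) * I" by (simp add: algebra_simps)
    finally show "cmod (fst (Z x)) \<le> K * (K / D + 1) * integral {0..1} (\<lambda>s. cmod (g s))" by (simp add: I_def)
  qed
qed

section \<open>Bounded inverse, eigenfunctions and the spectrum\<close>

lemma pencil_invertible:
  assumes d: "characteristic \<mu> \<noteq> 0"
  shows "boundedly_invertible (dom_A r) (pencil_T p r \<mu>)"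
proof -
  let ?S = "pencil_T p r \<mu>" and ?D = "dom_A r"
  let ?R = "inv_into ?D ?S"
  have inj: "inj_on ?S ?D"
  proof (rule inj_onI)
    fix Y Z assume *: "Y \<in> ?D" "Z \<in> ?D" "?S Y = ?S Z"
    obtain g where g: "sq_integrable g" "?S Y = abs_L2 g" by (rule L2_cases)
    obtain U where U: "bvp \<mu> g U" "Y = abs_L2 (\<lambda>s. fst (U s))" using pencil_iff[OF g(1), of Y \<mu>] * g(2) by blast
    obtain V where V: "bvp \<mu> g V" "Z = abs_L2 (\<lambda>s. fst (V s))" using pencil_iff[OF g(1), of Z \<mu>] * g(2) by auto
    show "Y = Z" unfolding U(2) V(2)
      using bvp_unique[OF d sq_integrable_int[OF g(1)] U(1) V(1)] by (intro abs_L2_cong bvpD(5)[OF U(1)]) simp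
  qed
  have solve: "\<exists>Z. bvp \<mu> g Z \<and> ?R (abs_L2 g) = abs_L2 (\<lambda>s. fst (Z s))" if g: "sq_integrable g" for g
  proof -
    obtain Z where Z: "bvp \<mu> g Z" using bvp_exists[OF d sq_integrable_int[OF g]] by blast
    then have "abs_L2 (\<lambda>s. fst (Z s)) \<in> ?D" "?S (abs_L2 (\<lambda>s. fst (Z s))) = abs_L2 g"
      using pencil_iff[OF g, of "abs_L2 (\<lambda>s. fst (Z s))" \<mu>] by blast+
    then have "?R (abs_L2 g) = abs_L2 (\<lambda>s. fst (Z s))" using inv_into_f_f[OF inj] by metis
    with Z show ?thesis by blast
  qed
  have inv: "?R (abs_L2 g) = abs_L2 (\<lambda>s. fst (Z s))" if g: "sq_integrable g" and Z: "bvp \<mu> g Z" for g Z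
  proof -
    have "abs_L2 (\<lambda>s. fst (Z s)) \<in> ?D" "?S (abs_L2 (\<lambda>s. fst (Z s))) = abs_L2 g"
      using pencil_iff[OF g, of "abs_L2 (\<lambda>s. fst (Z s))" \<mu>] Z by blast+
    then show ?thesis using inv_into_f_f[OF inj] by metis
  qed
  have surj: "?S ` ?D = UNIV"
  proof -
    have "G \<in> ?S ` ?D" for G
    proof -
      obtain g where g: "sq_integrable g" "G = abs_L2 g" by (rule L2_cases)
      obtain Z where Z: "bvp \<mu> g Z" using bvp_exists[OF d sq_integrable_int[OF g(1)]] by blast
      then have "abs_L2 (\<lambda>s. fst (Z s)) \<in> ?D" "?S (abs_L2 (\<lambda>s. fst (Z s))) = G"
        using pencil_iff[OF g(1), of "abs_L2 (\<lambda>s. fst (Z s))" \<mu>] unfolding g(2) by blast+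
      then show ?thesis by (metis imageI)
    qed
    then show ?thesis by blast
  qed
  obtain C where C: "C \<ge> 0" "\<And>g Z x. \<lbrakk>g absolutely_integrable_on {0..1}; bvp \<mu> g Z; x \<in> {0..1}\<rbrakk>
    \<Longrightarrow> cmod (fst (Z x)) \<le> C * integral {0..1} (\<lambda>s. cmod (g s))"
    using bvp_bound[OF d] by blast
  have "bounded_linear ?R"
  proof (rule bounded_linear_intro[where K = C])
    fix F G :: L2 and c :: real
    obtain f where f: "sq_integrable f" "F = abs_L2 f" by (rule L2_cases)
    obtain g where g: "sq_integrable g" "G = abs_L2 g" by (rule L2_cases)
    obtain U where U: "bvp \<mu> f U" "?R (abs_L2 f) = abs_L2 (\<lambda>s. fst (U s))" using solve[OF f(1)] by blast
    obtain V where V: "bvp \<mu> g V" "?R (abs_L2 g) = abs_L2 (\<lambda>s. fst (V s))" using solve[OF g(1)] by blast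
    note fi = sq_integrable_int[OF f(1)] and gi = sq_integrable_int[OF g(1)]
    have "bvp \<mu> (\<lambda>s. 1 * f s + 1 * g s) (\<lambda>s. cscale 1 (U s) + cscale 1 (V s))"
      by (rule bvp_combine[OF U(1) fi V(1) gi])
    then have "bvp \<mu> (\<lambda>s. f s + g s) (\<lambda>s. U s + V s)" by simp
    then show "?R (F + G) = ?R F + ?R G"
      unfolding f(2) g(2) U(2) V(2) L2_plus[OF f(1) g(1)] L2_plus[OF bvpD(5)[OF U(1)] bvpD(5)[OF V(1)]]
      using inv[OF sq_integrable_add[OF f(1) g(1)]] by simp
    have "bvp \<mu> (\<lambda>s. of_real c * f s + 0 * f s) (\<lambda>s. cscale (of_real c) (U s) + cscale 0 (U s))"
      by (rule bvp_combine[OF U(1) fi U(1) fi])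
    then have "bvp \<mu> (\<lambda>s. of_real c * f s) (\<lambda>s. cscale (of_real c) (U s) + cscale 0 (U s))" by simp
    from inv[OF sq_integrable_mult_left[OF f(1)] this]
    show "?R (c *\<^sub>R F) = c *\<^sub>R ?R F"
      unfolding f(2) U(2) L2_scaleR[OF f(1)] L2_scaleR[OF bvpD(5)[OF U(1)]] by simp
    \<comment> \<open>The L_2 norm of y is at most its supremum, which is at most C times the
      integral of |f|, which is at most C times the L_2 norm of f, the interval having length
      1.\<close>
    have "norm (?R F) \<le> C * integral {0..1} (\<lambda>s. cmod (f s))"
      unfolding f(2) U(2)
    proof (rule norm_L2_le[OF bvpD(5)[OF U(1)]])
      show "C * integral {0..1} (\<lambda>s. cmod (f s)) \<ge> 0"
        using C(1) by (intro mult_nonneg_nonneg Henstock_Kurzweil_Integration.integral_nonneg)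
          (use absolutely_integrable_norm[OF fi] in \<open>auto simp: o_def set_lebesgue_integral_eq_integral(1)\<close>)
      show "cmod (fst (U x)) \<le> C * integral {0..1} (\<lambda>s. cmod (f s))" if "x \<in> {0..1}" for x
        by (rule C(2)[OF fi U(1) that])
    qed
    also have "\<dots> \<le> C * norm F"
      unfolding f(2) by (intro mult_left_mono integral_cmod_le_norm[OF f(1)] C(1))
    finally show "norm (?R F) \<le> norm F * C" by (simp add: mult.commute)
  qed
  then show ?thesis using inj surj by (simp add: boundedly_invertible_def bij_betw_def)
qed

lemma zero_L2_abs: "abs_L2 (\<lambda>s. 0) = 0"
  by (simp add: zero_L2.abs_eq)

text \<open>A zero of \<open>characteristic\<close> gives \<open>fund\<close> the missing boundary
  condition at 1. Its class is non-zero, for otherwise \<open>solution_fst_zero\<close> would make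
  its slope at 0 vanish.\<close>

lemma eigenfunction:
  assumes d: "characteristic \<mu> = 0"
  shows "bvp \<mu> (\<lambda>s. 0) (fund \<mu>)" "abs_L2 (\<lambda>s. fst (fund \<mu> s)) \<noteq> 0"
    "abs_L2 (\<lambda>s. fst (fund \<mu> s)) \<in> null_space (dom_A r) (pencil_T p r \<mu>)"
proof -
  show b: "bvp \<mu> (\<lambda>s. 0) (fund \<mu>)"
    using d fund by (simp add: bvp_def characteristic_def)
  show "abs_L2 (\<lambda>s. fst (fund \<mu> s)) \<in> null_space (dom_A r) (pencil_T p r \<mu>)"
    using b pencil_iff[OF sq_integrable_zero, of "abs_L2 (\<lambda>s. fst (fund \<mu> s))" \<mu>]
    unfolding null_space_def zero_L2_abs by blast
  show "abs_L2 (\<lambda>s. fst (fund \<mu> s)) \<noteq> 0"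
  proof
    assume "abs_L2 (\<lambda>s. fst (fund \<mu> s)) = 0"
    then have ae: "AE x in leb01. fst (fund \<mu> x) = 0"
      using abs_L2_eq_iff[OF bvpD(5)[OF b] sq_integrable_zero] by (simp add: zero_L2_abs)
    have "fst (fund \<mu> x) = 0" if "x \<in> {0..1}" for x
      by (rule continuous_AE_eq[OF bvpD(4)[OF b] continuous_on_const ae that])
    from solution_fst_zero(1)[OF zero_int fund(1) this, of 0] show False by (simp add: fund(2))
  qed
qed

lemma not_invertible:
  assumes "characteristic \<mu> = 0"
  shows "\<not> boundedly_invertible (dom_A r) (pencil_T p r \<mu>)"
proof
  assume "boundedly_invertible (dom_A r) (pencil_T p r \<mu>)"
  then have inj: "inj_on (pencil_T p r \<mu>) (dom_A r)" by (simp add: boundedly_invertible_def bij_betw_def)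
  note e = eigenfunction[OF assms]
  \<comment> \<open>The trivial combination shows that 0 lies in the domain and is mapped to 0;
    together with the eigenfunction this contradicts injectivity.\<close>
  have "bvp \<mu> (\<lambda>s. 0 * 0 + 0 * 0) (\<lambda>s. cscale 0 (fund \<mu> s) + cscale 0 (fund \<mu> s))"
    by (rule bvp_combine[OF e(1) zero_int e(1) zero_int])
  then have "bvp \<mu> (\<lambda>s. 0) (\<lambda>s. cscale 0 (fund \<mu> s) + cscale 0 (fund \<mu> s))" by simp
  then have "abs_L2 (\<lambda>s. fst (cscale 0 (fund \<mu> s) + cscale 0 (fund \<mu> s))) \<in> null_space (dom_A r) (pencil_T p r \<mu>)"
    using pencil_iff[OF sq_integrable_zero] unfolding null_space_def zero_L2_abs by blast
  then have "0 \<in> null_space (dom_A r) (pencil_T p r \<mu>)" by (simp add: zero_L2_abs)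
  then show False using inj_onD[OF inj, of "abs_L2 (\<lambda>s. fst (fund \<mu> s))" 0] e(2,3) by (simp add: null_space_def)
qed

lemma dim_null_space:
  assumes d: "characteristic \<mu> = 0"
  shows "L2.dim (null_space (dom_A r) (pencil_T p r \<mu>)) = 1"
proof (rule L2.dim_unique)
  let ?E = "abs_L2 (\<lambda>s. fst (fund \<mu> s))"
  note e = eigenfunction[OF d]
  show "{?E} \<subseteq> null_space (dom_A r) (pencil_T p r \<mu>)" using e(3) by blast
  show "L2.independent {?E}" using e(2) by simp
  show "null_space (dom_A r) (pencil_T p r \<mu>) \<subseteq> L2.span {?E}"
  proof
    fix Y assume "Y \<in> null_space (dom_A r) (pencil_T p r \<mu>)"
    then obtain Z where Z: "bvp \<mu> (\<lambda>s. 0) Z" and Y: "Y = abs_L2 (\<lambda>s. fst (Z s))"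
      using pencil_iff[OF sq_integrable_zero, of Y \<mu>] unfolding null_space_def zero_L2_abs by blast
    have "Y = snd (Z 0) *\<^sub>C ?E"
      unfolding Y L2_scaleC[OF bvpD(5)[OF e(1)]]
    proof (rule abs_L2_cong[OF bvpD(5)[OF Z]])
      fix x :: real assume "x \<in> {0..1}"
      from homogeneous_solution[OF bvpD(1,2)[OF Z] this]
      show "fst (Z x) = snd (Z 0) * fst (fund \<mu> x)" by (metis fst_cscale)
    qed
    then show "Y \<in> L2.span {?E}" unfolding L2.span_singleton by blast
  qed
qed simp

lemma pencil_spectrum_eq: "pencil_spectrum (dom_A r) (pencil_T p r) = {\<mu>. characteristic \<mu> = 0}"
  using pencil_invertible not_invertible
  by (auto simp: pencil_spectrum_def op_spectrum_def)

lemma characteristic_holomorphic: "characteristic holomorphic_on UNIV"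
  using characteristic_differentiable
  by (auto simp: holomorphic_on_def field_differentiable_def)

end

text \<open>Discreteness is taken in the strong sense, closed with isolated points only, so that the
  spectrum accumulates at no point of the plane.\<close>

theorem theorem3p6:
  fixes p r :: "real \<Rightarrow> real"
  assumes "sq_integrable p" and "sq_integrable r"
  defines "\<sigma> \<equiv> pencil_spectrum (dom_A r) (pencil_T p r)"
  shows "closed \<sigma> \<and> discrete \<sigma> \<and>
    (\<forall>\<mu>\<in>\<sigma>. pencil_eigenvalue (dom_A r) (pencil_T p r) \<mu> \<and>
            geometrically_simple (dom_A r) (pencil_T p r) \<mu>)"
proof -
  interpret singular_SL p r using assms(1,2) by unfold_locales
  have \<sigma>: "\<sigma> = {\<mu>. characteristic \<mu> = 0}" unfolding \<sigma>_def by (rule pencil_spectrum_eq)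
  have "continuous_on UNIV characteristic"
    by (rule holomorphic_on_imp_continuous_on[OF characteristic_holomorphic])
  then have "closed \<sigma>" unfolding \<sigma> by (intro closed_Collect_eq continuous_on_const)
  moreover have "discrete \<sigma>"
  proof (rule discreteI)
    fix \<mu> assume \<mu>: "\<mu> \<in> \<sigma>"
    have zero: "characteristic \<mu> = 0" using \<mu> unfolding \<sigma> by simp
    \<comment> \<open>One non-zero value suffices: on the connected plane it rules out that the
      entire function vanishes identically, so its zeros are isolated.\<close>
    obtain \<beta> where \<beta>: "characteristic \<beta> \<noteq> 0" using characteristic_nonzero by blast
    obtain \<rho> where \<rho>: "\<rho> > 0" "\<And>z. z \<in> ball \<mu> \<rho> - {\<mu>} \<Longrightarrow> characteristic z \<noteq> 0"
      using isolated_zeros[OF characteristic_holomorphic open_UNIV connected_UNIV UNIV_I zero UNIV_I \<beta>]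
      by metis
    have "z = \<mu>" if "z \<in> ball \<mu> \<rho> \<inter> \<sigma>" for z
      using \<rho>(2)[of z] that unfolding \<sigma> by blast
    moreover have "\<mu> \<in> ball \<mu> \<rho> \<inter> \<sigma>" using \<mu> \<rho>(1) by simp
    ultimately have "ball \<mu> \<rho> \<inter> \<sigma> = {\<mu>}" by blast
    then show "\<mu> isolated_in \<sigma>" unfolding isolated_in_def
      by (intro conjI \<mu> exI[of _ "ball \<mu> \<rho>"] open_ball)
  qed
  moreover have "pencil_eigenvalue (dom_A r) (pencil_T p r) \<mu>" if "\<mu> \<in> \<sigma>" for \<mu>
  proof -
    have "characteristic \<mu> = 0" using that \<sigma> by simp
    from eigenfunction[OF this] show ?thesis unfolding pencil_eigenvalue_def null_space_def by blast
  qed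
  moreover have "geometrically_simple (dom_A r) (pencil_T p r) \<mu>" if "\<mu> \<in> \<sigma>" for \<mu>
    using that dim_null_space \<sigma> by (simp add: geometrically_simple_def)
  ultimately show ?thesis by blast
qed

end
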